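(* Let $k$ be a field of characteristic different from $3$ and $a,d\in k$ such that the twisted Hessian curve $E: aX^3+Y^3+Z^3=dXYZ$ in $\mathbb{P}^2$ is nonsingular, with identity $O=(0:-1:1)$. Write $P=(X_1:Y_1:Z_1)$, $Q=(X_2:Y_2:Z_2)$. The $k$-vector space of addition laws of bidegree $(2,2)$ on $E$ is spanned by $$\begin{aligned}\mathfrak{s}_0&=(X_1^2Y_2Z_2-Y_1Z_1X_2^2,\ Z_1^2X_2Y_2-X_1Y_1Z_2^2,\ Y_1^2X_2Z_2-X_1Z_1Y_2^2),\\ \mathfrak{s}_1&=(X_1Y_1Y_2^2-Z_1^2X_2Z_2,\ aX_1Z_1X_2^2-Y_1^2Y_2Z_2,\ Y_1Z_1Z_2^2-aX_1^2X_2Y_2),\\ \mathfrak{s}_2&=(X_1Z_1Z_2^2-Y_1^2X_2Y_2,\ Y_1Z_1Y_2^2-aX_1^2X_2Z_2,\ aX_1Y_1X_2^2-Z_1^2Y_2Z_2).\end{aligned}$$ Moreover, each $\mathfrak{s}_i$ is an eigenvector for the action of $G_1$, where $G$ is the order-$3$ subgroup of $E$ consisting of the points with $X=0$.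
   Context: An addition law of bidegree $(2,2)$ is a triple of polynomials in $(X_1,Y_1,Z_1),(X_2,Y_2,Z_2)$, bihomogeneous of bidegree $(2,2)$, considered modulo the bihomogeneous ideal of $E\times E$ and not all zero modulo it, such that evaluating at $(P,Q)$ gives projective coordinates of $P+Q$ whenever not all three vanish; these together with $0$ form a $k$-vector space. For $R\in G$, translation $\tau_R$ is induced by a linear map $L_R$ of the coordinates (defined up to scalar). The group $G_1=\{(R,-R,O):R\in G\}$ acts on addition laws by $(R,-R,O)\cdot\mathfrak{s}=\mathfrak{s}\circ(L_R\times L_{-R})$, i.e. $\mathfrak{s}(P,Q)\mapsto\mathfrak{s}(P+R,Q-R)$; $\mathfrak{s}$ is an eigenvector if $(R,-R,O)\cdot\mathfrak{s}$ is a nonzero scalar multiple of $\mathfrak{s}$ (modulo the ideal of $E\times E$) for all $R\in G$ (scalars in $\bar k$). *)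

theory Defs
  imports
    "HOL-Analysis.Analysis"
    "HOL-Library.Poly_Mapping"
    "HOL-Algebra.Algebraic_Closure_Type"
begin

section \<open>The twisted Hessian curve and its chord-tangent group law\<close>

text \<open>
  A point of the projective plane over a field is represented by a nonzero vector of homogeneous
  coordinates \<open>(X, Y, Z) = (P $ 1, P $ 2, P $ 3)\<close>; all notions below are invariant under rescaling.
  They are used over the algebraic closure, so that points are geometric points.
\<close>

definition hessian_form :: "'a::field \<Rightarrow> 'a \<Rightarrow> 'a ^ 3 \<Rightarrow> 'a" where
  "hessian_form a d P = a * (P$1) ^ 3 + (P$2) ^ 3 + (P$3) ^ 3 - d * P$1 * P$2 * P$3"

definition hessian_gradient :: "'a::field \<Rightarrow> 'a \<Rightarrow> 'a ^ 3 \<Rightarrow> 'a ^ 3" where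
  "hessian_gradient a d P = vector
     [3 * a * (P$1)\<^sup>2 - d * P$2 * P$3,
      3 * (P$2)\<^sup>2 - d * P$1 * P$3,
      3 * (P$3)\<^sup>2 - d * P$1 * P$2]"

definition curve :: "'a::field \<Rightarrow> 'a \<Rightarrow> ('a ^ 3) set" where
  "curve a d = {P. P \<noteq> 0 \<and> hessian_form a d P = 0}"

definition hessian_nonsingular :: "'a::field \<Rightarrow> 'a \<Rightarrow> bool" where
  "hessian_nonsingular a d \<longleftrightarrow>
     (\<forall>P \<in> curve (to_ac a) (to_ac d). hessian_gradient (to_ac a) (to_ac d) P \<noteq> 0)"

text \<open>
  The points \<open>P, Q, T\<close> form the intersection cycle of the curve with a line: the line is spanned by
  \<open>u\<close> and \<open>v\<close>, and the restriction of the cubic form to it is a nonzero multiple of the product of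
  the linear forms vanishing at \<open>P\<close>, \<open>Q\<close> and \<open>T\<close>. Multiplicities are thus accounted for; for
  \<open>P = Q\<close> the line is tangent at \<open>P\<close>. (Over an infinite field, equality of the values for
  all \<open>x, y\<close> is equality of binary forms.)
\<close>
definition line_section :: "'a::field \<Rightarrow> 'a \<Rightarrow> 'a ^ 3 \<Rightarrow> 'a ^ 3 \<Rightarrow> 'a ^ 3 \<Rightarrow> bool" where
  "line_section a d P Q T \<longleftrightarrow> P \<noteq> 0 \<and> Q \<noteq> 0 \<and> T \<noteq> 0 \<and>
     (\<exists>u v p1 p2 q1 q2 t1 t2 c.
        (\<forall>x y. x *s u + y *s v = 0 \<longrightarrow> x = 0 \<and> y = 0) \<and>
        P = p1 *s u + p2 *s v \<and> Q = q1 *s u + q2 *s v \<and> T = t1 *s u + t2 *s v \<and>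
        c \<noteq> 0 \<and>
        (\<forall>x y. hessian_form a d (x *s u + y *s v) =
           c * (p2 * x - p1 * y) * (q2 * x - q1 * y) * (t2 * x - t1 * y)))"

definition origin :: "'a::field ^ 3" where
  "origin = vector [0, - 1, 1]"

text \<open>
  \<open>is_sum a d P Q S\<close>: the vector \<open>S\<close> consists of homogeneous coordinates of \<open>P + Q\<close>. If \<open>T\<close> is the
  third intersection point of the line through \<open>P\<close> and \<open>Q\<close>, then \<open>P + Q\<close> is the third
  intersection point of the line through \<open>O\<close> and \<open>T\<close>.
\<close>
definition is_sum :: "'a::field \<Rightarrow> 'a \<Rightarrow> 'a ^ 3 \<Rightarrow> 'a ^ 3 \<Rightarrow> 'a ^ 3 \<Rightarrow> bool" where
  "is_sum a d P Q S \<longleftrightarrow> (\<exists>T. line_section a d P Q T \<and> line_section a d origin T S)"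


section \<open>Polynomials in two sets of projective coordinates\<close>

text \<open>
  Variables are indexed by \<open>3 + 3\<close>: \<open>Inl i\<close> for \<open>X\<^sub>1, Y\<^sub>1, Z\<^sub>1\<close> and \<open>Inr i\<close> for \<open>X\<^sub>2, Y\<^sub>2, Z\<^sub>2\<close>
  (\<open>i = 1, 2, 3\<close>).
\<close>
type_synonym 'a bipoly = "((3 + 3) \<Rightarrow>\<^sub>0 nat) \<Rightarrow>\<^sub>0 'a"

definition Const :: "'a::zero \<Rightarrow> 'a bipoly" where
  "Const c = Poly_Mapping.single 0 c"

definition Var :: "3 + 3 \<Rightarrow> 'a::zero_neq_one bipoly" where
  "Var x = Poly_Mapping.single (Poly_Mapping.single x 1) 1"

text \<open>Apply \<open>h\<close> to the coefficients and substitute \<open>v\<close> for the variables.\<close>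
definition subst_poly ::
  "('a::zero \<Rightarrow> 'b::comm_semiring_1) \<Rightarrow> (3 + 3 \<Rightarrow> 'b) \<Rightarrow> 'a bipoly \<Rightarrow> 'b" where
  "subst_poly h v p =
     (\<Sum>m \<in> Poly_Mapping.keys p. h (Poly_Mapping.lookup p m) *
        (\<Prod>x \<in> UNIV. v x ^ Poly_Mapping.lookup m x))"

definition eval_at :: "'a::comm_semiring_1 ^ 3 \<Rightarrow> 'a ^ 3 \<Rightarrow> 'a bipoly \<Rightarrow> 'a" where
  "eval_at P Q = subst_poly (\<lambda>c. c) (case_sum (($) P) (($) Q))"

definition bihomogeneous :: "nat \<Rightarrow> nat \<Rightarrow> 'a::zero bipoly \<Rightarrow> bool" where
  "bihomogeneous m n p \<longleftrightarrow> (\<forall>e \<in> Poly_Mapping.keys p.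
     (\<Sum>i \<in> UNIV. Poly_Mapping.lookup e (Inl i)) = m \<and>
     (\<Sum>i \<in> UNIV. Poly_Mapping.lookup e (Inr i)) = n)"

definition base_change :: "'a::field bipoly \<Rightarrow> 'a alg_closure bipoly" where
  "base_change = Poly_Mapping.map to_ac"

text \<open>
  The bihomogeneous ideal of \<open>E \<times> E\<close> over the algebraic closure. As \<open>curve\<close> is closed under
  rescaling, a polynomial belongs to it iff all its bihomogeneous components vanish on \<open>E \<times> E\<close>.
\<close>
definition product_ideal :: "'a::field \<Rightarrow> 'a \<Rightarrow> 'a alg_closure bipoly set" where
  "product_ideal a d =
     {p. \<forall>P \<in> curve (to_ac a) (to_ac d). \<forall>Q \<in> curve (to_ac a) (to_ac d). eval_at P Q p = 0}"

definition base_change3 :: "'a::field bipoly ^ 3 \<Rightarrow> 'a alg_closure bipoly ^ 3" where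
  "base_change3 s = (\<chi> i. base_change (s $ i))"

definition eval3_at :: "'a::comm_semiring_1 ^ 3 \<Rightarrow> 'a ^ 3 \<Rightarrow> 'a bipoly ^ 3 \<Rightarrow> 'a ^ 3" where
  "eval3_at P Q s = (\<chi> i. eval_at P Q (s $ i))"

definition cong_EE ::
  "'a::field \<Rightarrow> 'a \<Rightarrow> 'a alg_closure bipoly ^ 3 \<Rightarrow> 'a alg_closure bipoly ^ 3 \<Rightarrow> bool" where
  "cong_EE a d s t \<longleftrightarrow> (\<forall>i. s $ i - t $ i \<in> product_ideal a d)"

definition scale3 :: "'a::comm_ring_1 \<Rightarrow> 'a bipoly ^ 3 \<Rightarrow> 'a bipoly ^ 3" where
  "scale3 c s = Const c *s s"

global_interpretation triples: vector_space "scale3 :: 'a::field \<Rightarrow> 'a bipoly ^ 3 \<Rightarrow> 'a bipoly ^ 3"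
  by unfold_locales
    (simp_all add: scale3_def Const_def vec_eq_iff single_add mult_single
       algebra_simps flip: mult.assoc)


section \<open>Addition laws\<close>

definition bidegree22 :: "('a::zero bipoly ^ 3) set" where
  "bidegree22 = {s. \<forall>i. bihomogeneous 2 2 (s $ i)}"

definition addition_law :: "'a::field \<Rightarrow> 'a \<Rightarrow> 'a bipoly ^ 3 \<Rightarrow> bool" where
  "addition_law a d s \<longleftrightarrow>
     s \<in> bidegree22 \<and>
     \<not> cong_EE a d (base_change3 s) 0 \<and>
     (\<forall>P \<in> curve (to_ac a) (to_ac d). \<forall>Q \<in> curve (to_ac a) (to_ac d).
        eval3_at P Q (base_change3 s) \<noteq> 0 \<longrightarrow>
        is_sum (to_ac a) (to_ac d) P Q (eval3_at P Q (base_change3 s)))"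

text \<open>
  The addition laws together with zero, where triples congruent modulo the ideal of \<open>E \<times> E\<close>
  represent the same element.
\<close>
definition addition_law_space :: "'a::field \<Rightarrow> 'a \<Rightarrow> ('a bipoly ^ 3) set" where
  "addition_law_space a d =
     {s \<in> bidegree22. addition_law a d s \<or> cong_EE a d (base_change3 s) 0}"


section \<open>The action of pairs of translations\<close>

definition subgroup_X0 :: "'a::field \<Rightarrow> 'a \<Rightarrow> ('a alg_closure ^ 3) set" where
  "subgroup_X0 a d = {R \<in> curve (to_ac a) (to_ac d). R $ 1 = 0}"

definition induces_translation ::
  "'a::field \<Rightarrow> 'a \<Rightarrow> 'a alg_closure ^ 3 \<Rightarrow> 'a alg_closure ^ 3 ^ 3 \<Rightarrow> bool" where
  "induces_translation a d R L \<longleftrightarrow>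
     (\<forall>P \<in> curve (to_ac a) (to_ac d). is_sum (to_ac a) (to_ac d) P R (L *v P))"

text \<open>\<open>L = L\<^sub>R\<close> and \<open>M = L\<^bsub>-R\<^esub>\<close>, each being determined up to a scalar.\<close>
definition represents_pair ::
  "'a::field \<Rightarrow> 'a \<Rightarrow> 'a alg_closure ^ 3 \<Rightarrow> 'a alg_closure ^ 3 ^ 3 \<Rightarrow> 'a alg_closure ^ 3 ^ 3 \<Rightarrow> bool"
  where
  "represents_pair a d R L M \<longleftrightarrow>
     (\<exists>R' \<in> curve (to_ac a) (to_ac d). is_sum (to_ac a) (to_ac d) R R' origin \<and>
        induces_translation a d R L \<and> induces_translation a d R' M)"

text \<open>The composition \<open>s \<circ> (L \<times> M)\<close>.\<close>
definition compose_linear ::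
  "'a::comm_ring_1 ^ 3 ^ 3 \<Rightarrow> 'a ^ 3 ^ 3 \<Rightarrow> 'a bipoly ^ 3 \<Rightarrow> 'a bipoly ^ 3" where
  "compose_linear L M s = (\<chi> i. subst_poly Const
     (case_sum (\<lambda>j. \<Sum>l \<in> UNIV. Const (L $ j $ l) * Var (Inl l))
               (\<lambda>j. \<Sum>l \<in> UNIV. Const (M $ j $ l) * Var (Inr l))) (s $ i))"

definition G1_eigenvector :: "'a::field \<Rightarrow> 'a \<Rightarrow> 'a bipoly ^ 3 \<Rightarrow> bool" where
  "G1_eigenvector a d s \<longleftrightarrow>
     addition_law a d s \<and>
     (\<forall>R \<in> subgroup_X0 a d.
        (\<exists>L M. represents_pair a d R L M) \<and>
        (\<forall>L M. represents_pair a d R L M \<longrightarrow>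
           (\<exists>c. c \<noteq> 0 \<and>
              cong_EE a d (compose_linear L M (base_change3 s)) (scale3 c (base_change3 s)))))"


section \<open>The three explicit triples\<close>

abbreviation X1 :: "'a::zero_neq_one bipoly" where "X1 \<equiv> Var (Inl 1)"
abbreviation Y1 :: "'a::zero_neq_one bipoly" where "Y1 \<equiv> Var (Inl 2)"
abbreviation Z1 :: "'a::zero_neq_one bipoly" where "Z1 \<equiv> Var (Inl 3)"
abbreviation X2 :: "'a::zero_neq_one bipoly" where "X2 \<equiv> Var (Inr 1)"
abbreviation Y2 :: "'a::zero_neq_one bipoly" where "Y2 \<equiv> Var (Inr 2)"
abbreviation Z2 :: "'a::zero_neq_one bipoly" where "Z2 \<equiv> Var (Inr 3)"

definition law0 :: "'a::field bipoly ^ 3" where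
  "law0 = vector
     [X1\<^sup>2 * Y2 * Z2 - Y1 * Z1 * X2\<^sup>2,
      Z1\<^sup>2 * X2 * Y2 - X1 * Y1 * Z2\<^sup>2,
      Y1\<^sup>2 * X2 * Z2 - X1 * Z1 * Y2\<^sup>2]"

definition law1 :: "'a::field \<Rightarrow> 'a bipoly ^ 3" where
  "law1 a = vector
     [X1 * Y1 * Y2\<^sup>2 - Z1\<^sup>2 * X2 * Z2,
      Const a * X1 * Z1 * X2\<^sup>2 - Y1\<^sup>2 * Y2 * Z2,
      Y1 * Z1 * Z2\<^sup>2 - Const a * X1\<^sup>2 * X2 * Y2]"

definition law2 :: "'a::field \<Rightarrow> 'a bipoly ^ 3" where
  "law2 a = vector
     [X1 * Z1 * Z2\<^sup>2 - Y1\<^sup>2 * X2 * Y2,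
      Y1 * Z1 * Y2\<^sup>2 - Const a * X1\<^sup>2 * X2 * Z2,
      Const a * X1 * Y1 * X2\<^sup>2 - Z1\<^sup>2 * Y2 * Z2]"

end

theory Submission
  imports Defs
begin

text \<open>
  The three laws are proportional on \<open>E \<times> E\<close>, since their \<open>2 \<times> 2\<close> minors lie in the ideal of the two
  curve equations, and the combination \<open>3 s\<^sub>1 + 3 s\<^sub>2 - d s\<^sub>0\<close> is the chord construction itself; so
  wherever one of them does not vanish it computes \<open>P + Q\<close> (the diagonal is treated by the tangent).

  For the converse, let \<open>s\<close> be an addition law with first coordinate \<open>f\<close>. Then \<open>f\<close> vanishes on the three
  curves \<open>X(P + Q) = 0\<close>, that is, on \<open>Q = (X, w\<^sup>i Z, w\<^sup>2\<^sup>i Y)\<close> for \<open>P = (X, Y, Z)\<close> and a primitive cube root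
  of unity \<open>w\<close>. Separating weights, this says that three quartic forms vanish on \<open>E\<close>, which forces
  \<open>f\<close> to be a combination of the first coordinates of the \<open>s\<^sub>i\<close>, with coefficients read off from \<open>f\<close>.
  After subtracting that combination, \<open>s\<close> has first coordinate zero, so it vanishes unless
  \<open>X(P + Q) = 0\<close>. For fixed \<open>P\<close> this leaves finitely many \<open>Q\<close>, and a quadratic form vanishing at
  almost all points of \<open>E\<close> is zero.
\<close>

text \<open>The first coordinate is the convenient one because \<open>P + Q\<close> has X = 0
  exactly when Q = R - P with R in G, and translation by a point of G is a diagonal matrix. The
  locus X(P + Q) = 0 thus consists of the graphs of three diagonal twists of the negation (X, Y, Z)
  -> (X, Z, Y), and the cube roots of unity on the diagonal grade the quadratic monomials in Q; this
  grading is what the weights refer to. The group law enters only through uniqueness of the third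
  intersection point, which rests on a nowhere vanishing gradient and on E containing no line. The
  chord vector is the remaining root of the cubic restricted to the line PQ; it is identically zero
  for P = Q, hence the separate tangent computation. Vanishing is tested over the algebraic closure,
  whereas the span is taken over k. This causes no descent problem: the coefficients of the
  combination are coefficients of f itself.\<close>

no_notation fps_nth (infixl "$" 75)

section \<open>Line sections and the group law\<close>

lemma vec3_eq_iff: "(u = v) \<longleftrightarrow> u $ 1 = v $ 1 \<and> u $ 2 = v $ 2 \<and> u $ 3 = v $ (3::3)"
  by (simp add: vec_eq_iff forall_3)

definition independent_pair :: "'a::field ^ 3 \<Rightarrow> 'a ^ 3 \<Rightarrow> bool" where
  "independent_pair u v \<longleftrightarrow> (\<forall>x y. x *s u + y *s v = 0 \<longrightarrow> x = 0 \<and> y = 0)"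

text \<open>The coefficient of x^2 y in the cubic form at xP + yQ. Where the gradient at
  \<open>P\<close> is nonzero, its zeros in \<open>Q\<close> form the tangent line at
  \<open>P\<close>.\<close>

definition polar :: "'a::field \<Rightarrow> 'a \<Rightarrow> 'a ^ 3 \<Rightarrow> 'a ^ 3 \<Rightarrow> 'a" where
  "polar a d P Q = (\<Sum>i\<in>UNIV. hessian_gradient a d P $ i * Q $ i)"

lemma polar_eq:
  "polar a d P Q = (3 * a * (P$1)\<^sup>2 - d * P$2 * P$3) * Q$1 +
      (3 * (P$2)\<^sup>2 - d * P$1 * P$3) * Q$2 + (3 * (P$3)\<^sup>2 - d * P$1 * P$2) * Q$3"
  by (simp add: polar_def hessian_gradient_def sum_3)

lemma hessian_form_lincomb:
  "hessian_form a d (x *s P + y *s Q) = x ^ 3 * hessian_form a d P + x\<^sup>2 * y * polar a d P Q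
      + x * y\<^sup>2 * polar a d Q P + y ^ 3 * hessian_form a d Q"
  by (simp add: hessian_form_def polar_eq algebra_simps power2_eq_square power3_eq_cube)

text \<open>The right-hand side says that the cross product is nonzero; in this shape independence
  of explicit vectors is settled by computation.\<close>

lemma independent_pair_cross:
  "independent_pair u v \<longleftrightarrow>
     u$2 * v$3 \<noteq> u$3 * v$2 \<or> u$3 * v$1 \<noteq> u$1 * v$3 \<or> u$1 * v$2 \<noteq> u$2 * v$1"
  (is "_ \<longleftrightarrow> ?N")
proof
  assume ind: "independent_pair u v"
  show ?N
  proof (rule ccontr)
    assume n: "\<not> ?N"
    have "(v$i) *s u + (- u$i) *s v = 0" for i
      using n exhaust_3[of i] by (auto simp: vec3_eq_iff algebra_simps)
    then have "u $ i = 0" for i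
      using ind unfolding independent_pair_def by (metis neg_equal_0_iff_equal)
    then have "1 *s u + 0 *s v = 0" by (simp add: vec3_eq_iff)
    then show False using ind unfolding independent_pair_def by (metis one_neq_zero)
  qed
next
  assume n: ?N
  show "independent_pair u v" unfolding independent_pair_def
  proof (intro allI impI)
    fix x y assume "x *s u + y *s v = 0"
    then have e: "x * u$1 + y * v$1 = 0" "x * u$2 + y * v$2 = 0" "x * u$3 + y * v$3 = 0"
      by (simp_all add: vec3_eq_iff)
    have "x * (u$i * v$j - u$j * v$i) = v$j * (x * u$i + y * v$i) - v$i * (x * u$j + y * v$j)"
      "y * (u$i * v$j - u$j * v$i) = u$i * (x * u$j + y * v$j) - u$j * (x * u$i + y * v$i)" for i j
      by (simp_all add: algebra_simps)
    then have "x * (u$i * v$j - u$j * v$i) = 0 \<and> y * (u$i * v$j - u$j * v$i) = 0" for i j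
      using e exhaust_3[of i] exhaust_3[of j] by auto
    then show "x = 0 \<and> y = 0"
      using n by (metis eq_iff_diff_eq_0 mult_eq_0_iff)
  qed
qed

text \<open>The case split behind every chord-or-tangent argument: two vectors represent distinct
  points or the same point.\<close>

lemma proportional_or_independent:
  assumes "P \<noteq> 0"
  obtains "independent_pair P Q" | l where "Q = l *s P"
proof (cases "independent_pair P Q")
  case False
  then obtain x y where xy: "x *s P + y *s Q = 0" "\<not> (x = 0 \<and> y = 0)"
    unfolding independent_pair_def by blast
  have y: "y \<noteq> 0"
  proof
    assume "y = 0"
    then have "x *s P = 0" "x \<noteq> 0" using xy by auto
    then show False using assms by (simp add: vec_eq_iff)
  qed
  have "Q = (- x / y) *s P" using xy(1) y
    by (simp add: vec3_eq_iff field_simps eq_neg_iff_add_eq_0)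
  then show thesis using that by blast
qed (use that in blast)

text \<open>Three vectors orthogonal to a nonzero \<open>n\<close> have determinant zero, by
  Cramer's rule applied to the three orthogonality relations. A nonzero 2 x 2 minor of
  \<open>u\<close>, \<open>v\<close> then yields the coefficients, again by Cramer.\<close>

lemma plane_lincomb:
  fixes n u v w :: "'a::field ^ 3"
  assumes n: "n \<noteq> 0" and uv: "independent_pair u v"
    and u: "(\<Sum>i\<in>UNIV. n$i * u$i) = 0" and v: "(\<Sum>i\<in>UNIV. n$i * v$i) = 0"
    and w: "(\<Sum>i\<in>UNIV. n$i * w$i) = 0"
  obtains x y where "w = x *s u + y *s v"
proof -
  have e: "n$1 * u$1 + n$2 * u$2 + n$3 * u$3 = 0" "n$1 * v$1 + n$2 * v$2 + n$3 * v$3 = 0"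
    "n$1 * w$1 + n$2 * w$2 + n$3 * w$3 = 0"
    using u v w by (simp_all add: sum_3)
  let ?m1 = "u$2 * v$3 - u$3 * v$2" and ?m2 = "u$3 * v$1 - u$1 * v$3"
    and ?m3 = "u$1 * v$2 - u$2 * v$1"
  let ?D = "?m1 * w$1 + ?m2 * w$2 + ?m3 * w$3"
  have "n$1 * ?D = (v$2 * w$3 - v$3 * w$2) * (n$1 * u$1 + n$2 * u$2 + n$3 * u$3)
      + (w$2 * u$3 - w$3 * u$2) * (n$1 * v$1 + n$2 * v$2 + n$3 * v$3)
      + ?m1 * (n$1 * w$1 + n$2 * w$2 + n$3 * w$3)"
    "n$2 * ?D = (v$3 * w$1 - v$1 * w$3) * (n$1 * u$1 + n$2 * u$2 + n$3 * u$3)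
      + (w$3 * u$1 - w$1 * u$3) * (n$1 * v$1 + n$2 * v$2 + n$3 * v$3)
      + ?m2 * (n$1 * w$1 + n$2 * w$2 + n$3 * w$3)"
    "n$3 * ?D = (v$1 * w$2 - v$2 * w$1) * (n$1 * u$1 + n$2 * u$2 + n$3 * u$3)
      + (w$1 * u$2 - w$2 * u$1) * (n$1 * v$1 + n$2 * v$2 + n$3 * v$3)
      + ?m3 * (n$1 * w$1 + n$2 * w$2 + n$3 * w$3)"
    by (simp_all add: algebra_simps)
  then have "n$1 * ?D = 0" "n$2 * ?D = 0" "n$3 * ?D = 0"
    unfolding e by simp_all
  then have D: "?D = 0" using n by (auto simp: vec3_eq_iff)
  consider "?m1 \<noteq> 0" | "?m2 \<noteq> 0" | "?m3 \<noteq> 0"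
    using uv unfolding independent_pair_cross by auto
  then show thesis
  proof cases
    case 1
    let ?x = "(w$2 * v$3 - w$3 * v$2) / ?m1" and ?y = "(u$2 * w$3 - u$3 * w$2) / ?m1"
    have "(w$2 * v$3 - w$3 * v$2) * u$1 + (u$2 * w$3 - u$3 * w$2) * v$1 = ?m1 * w$1 - ?D"
      "(w$2 * v$3 - w$3 * v$2) * u$2 + (u$2 * w$3 - u$3 * w$2) * v$2 = ?m1 * w$2"
      "(w$2 * v$3 - w$3 * v$2) * u$3 + (u$2 * w$3 - u$3 * w$2) * v$3 = ?m1 * w$3"
      by (simp_all add: algebra_simps)
    then have "w = ?x *s u + ?y *s v" using 1 unfolding D
      by (simp add: vec3_eq_iff add_divide_distrib[symmetric] eq_divide_eq mult.commute)
    then show ?thesis using that by blast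
  next
    case 2
    let ?x = "(w$3 * v$1 - w$1 * v$3) / ?m2" and ?y = "(u$3 * w$1 - u$1 * w$3) / ?m2"
    have "(w$3 * v$1 - w$1 * v$3) * u$2 + (u$3 * w$1 - u$1 * w$3) * v$2 = ?m2 * w$2 - ?D"
      "(w$3 * v$1 - w$1 * v$3) * u$3 + (u$3 * w$1 - u$1 * w$3) * v$3 = ?m2 * w$3"
      "(w$3 * v$1 - w$1 * v$3) * u$1 + (u$3 * w$1 - u$1 * w$3) * v$1 = ?m2 * w$1"
      by (simp_all add: algebra_simps)
    then have "w = ?x *s u + ?y *s v" using 2 unfolding D
      by (simp add: vec3_eq_iff add_divide_distrib[symmetric] eq_divide_eq mult.commute)
    then show ?thesis using that by blast
  next
    case 3
    let ?x = "(w$1 * v$2 - w$2 * v$1) / ?m3" and ?y = "(u$1 * w$2 - u$2 * w$1) / ?m3"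
    have "(w$1 * v$2 - w$2 * v$1) * u$3 + (u$1 * w$2 - u$2 * w$1) * v$3 = ?m3 * w$3 - ?D"
      "(w$1 * v$2 - w$2 * v$1) * u$1 + (u$1 * w$2 - u$2 * w$1) * v$1 = ?m3 * w$1"
      "(w$1 * v$2 - w$2 * v$1) * u$2 + (u$1 * w$2 - u$2 * w$1) * v$2 = ?m3 * w$2"
      by (simp_all add: algebra_simps)
    then have "w = ?x *s u + ?y *s v" using 3 unfolding D
      by (simp add: vec3_eq_iff add_divide_distrib[symmetric] eq_divide_eq mult.commute)
    then show ?thesis using that by blast
  qed
qed

lemma quadratic_eq_0:
  fixes A B C :: "'a::alg_closed_field"
  assumes "infinite S" "\<And>y. y \<in> S \<Longrightarrow> A + B * y + C * y\<^sup>2 = 0"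
  shows "A = 0" "B = 0" "C = 0"
proof -
  have "poly [:A, B, C:] y = 0" if "y \<in> S" for y
    using assms(2)[OF that] by (simp add: algebra_simps power2_eq_square)
  then have "S \<subseteq> {y. poly [:A, B, C:] y = 0}" by auto
  then have "[:A, B, C:] = 0"
    using assms(1) poly_roots_finite finite_subset by blast
  then show "A = 0" "B = 0" "C = 0" by simp_all
qed

section \<open>Line sections: access to the definition, symmetry, rescaling\<close>

lemma line_section_cases:
  assumes "line_section a d P Q T"
  obtains u v p1 p2 q1 q2 t1 t2 c where
    "P \<noteq> 0" "Q \<noteq> 0" "T \<noteq> 0" "independent_pair u v"
    "P = p1 *s u + p2 *s v" "Q = q1 *s u + q2 *s v" "T = t1 *s u + t2 *s v" "c \<noteq> 0"
    "\<And>x y. hessian_form a d (x *s u + y *s v) =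
           c * (p2 * x - p1 * y) * (q2 * x - q1 * y) * (t2 * x - t1 * y)"
  using assms unfolding line_section_def independent_pair_def by blast

lemma line_sectionI:
  assumes "P \<noteq> 0" "Q \<noteq> 0" "T \<noteq> 0" "independent_pair u v"
    "P = p1 *s u + p2 *s v" "Q = q1 *s u + q2 *s v" "T = t1 *s u + t2 *s v" "c \<noteq> 0"
    "\<And>x y. hessian_form a d (x *s u + y *s v) =
           c * (p2 * x - p1 * y) * (q2 * x - q1 * y) * (t2 * x - t1 * y)"
  shows "line_section a d P Q T"
  using assms unfolding line_section_def independent_pair_def by blast

lemma line_section_swap12:
  assumes "line_section a d P Q T" shows "line_section a d Q P T"
proof -
  have swap: "c * p * q * t = c * q * p * t" for c p q t :: 'a by (simp add: mult_ac)
  show ?thesis using assms unfolding line_section_def by (subst (asm) swap) metis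
qed

lemma line_section_swap23:
  assumes "line_section a d P Q T" shows "line_section a d P T Q"
proof -
  have swap: "c * p * q * t = c * p * t * q" for c p q t :: 'a by (simp add: mult_ac)
  show ?thesis using assms unfolding line_section_def by (subst (asm) swap) metis
qed

lemma line_section_scale3:
  assumes "line_section a d P Q T" "k \<noteq> 0" shows "line_section a d P Q (k *s T)"
  using assms(1)
proof (elim line_section_cases)
  fix u v p1 p2 q1 q2 t1 t2 c
  assume H: "P \<noteq> 0" "Q \<noteq> 0" "T \<noteq> 0" "independent_pair u v"
    "P = p1 *s u + p2 *s v" "Q = q1 *s u + q2 *s v" "T = t1 *s u + t2 *s v" "c \<noteq> 0"
    "\<And>x y. hessian_form a d (x *s u + y *s v) =
           c * (p2 * x - p1 * y) * (q2 * x - q1 * y) * (t2 * x - t1 * y)"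
  show ?thesis
  proof (rule line_sectionI[OF H(1,2) _ H(4,5,6)])
    show "k *s T \<noteq> 0" using H(3) assms(2) by (simp add: vec_eq_iff)
    show "k *s T = (k * t1) *s u + (k * t2) *s v" using H(7) by (simp add: vec3_eq_iff algebra_simps)
    show "c / k \<noteq> 0" using H(8) assms(2) by simp
    show "hessian_form a d (x *s u + y *s v) =
        c / k * (p2 * x - p1 * y) * (q2 * x - q1 * y) * (k * t2 * x - k * t1 * y)" for x y
      unfolding H(9) using assms(2) by (simp add: field_simps)
  qed
qed

lemma line_section_scale2:
  assumes "line_section a d P Q T" "k \<noteq> 0" shows "line_section a d P (k *s Q) T"
  using assms line_section_swap23 line_section_scale3 by blast

lemma line_section_curve1:
  assumes "line_section a d P Q T" shows "P \<in> curve a d"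
  using assms unfolding line_section_def curve_def by fastforce

lemma line_section_curve2: "line_section a d P Q T \<Longrightarrow> Q \<in> curve a d"
  using line_section_swap12 line_section_curve1 by blast

lemma line_section_curve3: "line_section a d P Q T \<Longrightarrow> T \<in> curve a d"
  using line_section_swap23 line_section_curve2 by blast

lemma vec3_scale_eq_0_iff: "k *s (P :: 'a::field ^ 3) = 0 \<longleftrightarrow> k = 0 \<or> P = 0"
  by (auto simp: vec_eq_iff)

text \<open>In a finite field, the product of all X - x plus 1 has positive degree and no
  root.\<close>

lemma infinite_UNIV_alg_closed: "infinite (UNIV :: 'a::alg_closed_field set)"
proof
  assume fin: "finite (UNIV :: 'a set)"
  define p :: "'a poly" where "p = (\<Prod>x\<in>UNIV. [:-x, 1:]) + 1"
  have "poly p x = 1" for x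
    using fin by (simp add: p_def poly_prod prod_zero_iff)
  moreover have "Polynomial.degree (\<Prod>x\<in>(UNIV :: 'a set). [:-x, 1:]) > 0"
    using fin by (simp add: degree_prod_eq_sum_degree finite_UNIV_card_ge_0)
  then have "Polynomial.degree p > 0"
    unfolding p_def by (subst degree_add_eq_left) simp_all
  ultimately show False
    using alg_closed_imp_poly_has_root by (metis one_neq_zero)
qed

lemma infinite_nonzero: "infinite (- {0 :: 'a::alg_closed_field})"
  using infinite_UNIV_alg_closed by (simp add: Compl_eq_Diff_UNIV)

section \<open>The cubic restricted to a line, and the third intersection point\<close>

lemma independent_pairD:
  "independent_pair u v \<Longrightarrow> x *s u + y *s v = 0 \<Longrightarrow> x = 0 \<and> y = 0"
  unfolding independent_pair_def by blast

lemma independent_pair_unique: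
  assumes "independent_pair u v" "x *s u + y *s v = x' *s u + y' *s v"
  shows "x = x'" "y = y'"
proof -
  have "(x - x') *s u + (y - y') *s v = 0"
    using assms(2) by (simp add: vec3_eq_iff algebra_simps)
  from independent_pairD[OF assms(1) this] show "x = x'" "y = y'" by simp_all
qed

text \<open>A change of basis from \<open>u\<close>, \<open>v\<close> to \<open>P\<close>,
  \<open>w\<close>: each linear factor becomes a combination of 2 x 2 determinants, and the factor
  belonging to \<open>P\<close> loses its \<open>x\<close> term.\<close>

lemma hessian_form_on_section:
  assumes "\<And>x y. hessian_form a d (x *s u + y *s v) =
           c * (p2 * x - p1 * y) * (q2 * x - q1 * y) * (t2 * x - t1 * y)"
    and "P = p1 *s u + p2 *s v" and "w = w1 *s u + w2 *s v"
  shows "hessian_form a d (x *s P + y *s w) = c * (y * (p2 * w1 - p1 * w2))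
     * (x * (q2 * p1 - q1 * p2) + y * (q2 * w1 - q1 * w2))
     * (x * (t2 * p1 - t1 * p2) + y * (t2 * w1 - t1 * w2))"
proof -
  have "x *s P + y *s w = (x * p1 + y * w1) *s u + (x * p2 + y * w2) *s v"
    using assms(2,3) by (simp add: vec3_eq_iff algebra_simps)
  then have "hessian_form a d (x *s P + y *s w)
      = c * (p2 * (x * p1 + y * w1) - p1 * (x * p2 + y * w2))
        * (q2 * (x * p1 + y * w1) - q1 * (x * p2 + y * w2))
        * (t2 * (x * p1 + y * w1) - t1 * (x * p2 + y * w2))"
    by (simp only: assms(1))
  moreover have "p2 * (x * p1 + y * w1) - p1 * (x * p2 + y * w2) = y * (p2 * w1 - p1 * w2)"
    "q2 * (x * p1 + y * w1) - q1 * (x * p2 + y * w2)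
      = x * (q2 * p1 - q1 * p2) + y * (q2 * w1 - q1 * w2)"
    "t2 * (x * p1 + y * w1) - t1 * (x * p2 + y * w2)
      = x * (t2 * p1 - t1 * p2) + y * (t2 * w1 - t1 * w2)"
    by (simp_all add: algebra_simps)
  ultimately show ?thesis by (simp only:)
qed

lemma independent_in_plane:
  assumes "P = p1 *s u + p2 *s v" "w = w1 *s u + w2 *s v" "independent_pair P w"
  shows "p2 * w1 - p1 * w2 \<noteq> 0"
proof
  assume z: "p2 * w1 - p1 * w2 = 0"
  have "w1 *s P + (- p1) *s w = (p2 * w1 - p1 * w2) *s v"
    "w2 *s P + (- p2) *s w = - (p2 * w1 - p1 * w2) *s u"
    using assms(1,2) by (simp_all add: vec3_eq_iff algebra_simps)
  then have "w1 *s P + (- p1) *s w = 0" "w2 *s P + (- p2) *s w = 0"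
    unfolding z by simp_all
  then have "w1 = 0 \<and> w2 = 0" using assms(3) unfolding independent_pair_def by blast
  then have "0 *s P + 1 *s w = 0" using assms(2) by (simp add: vec3_eq_iff)
  then show False using assms(3) unfolding independent_pair_def by (metis one_neq_zero)
qed

text \<open>On the line PQ the cubic is xy(Ax + By) with A = \<open>polar a d P Q\<close> and B =
  \<open>polar a d Q P\<close>, so the remaining root is (x : y) = (B : -A). The point obtained does
  not mention \<open>T\<close>.\<close>

lemma third_point_secant:
  fixes a :: "'a::alg_closed_field"
  assumes "line_section a d P Q T" "independent_pair P Q"
  obtains k where "k \<noteq> 0" "polar a d Q P *s P - polar a d P Q *s Q = k *s T"
  using assms(1)
proof (elim line_section_cases)
  fix u v p1 p2 q1 q2 t1 t2 c
  assume H: "P \<noteq> 0" "Q \<noteq> 0" "T \<noteq> 0" "independent_pair u v"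
    "P = p1 *s u + p2 *s v" "Q = q1 *s u + q2 *s v" "T = t1 *s u + t2 *s v" "c \<noteq> 0"
    "\<And>x y. hessian_form a d (x *s u + y *s v) =
           c * (p2 * x - p1 * y) * (q2 * x - q1 * y) * (t2 * x - t1 * y)"
  define e where "e = p2 * q1 - p1 * q2"
  have e: "e \<noteq> 0" unfolding e_def by (rule independent_in_plane[OF H(5,6) assms(2)])
  have F0: "hessian_form a d P = 0" "hessian_form a d Q = 0"
    using line_section_curve1[OF assms(1)] line_section_curve2[OF assms(1)]
    by (auto simp: curve_def)
  define A B where "A = polar a d P Q" and "B = polar a d Q P"
  have "0 + (A + c * e\<^sup>2 * (t2 * p1 - t1 * p2)) * y + (B + c * e\<^sup>2 * (t2 * q1 - t1 * q2)) * y\<^sup>2 = 0" for y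
  proof -
    have "A * y + B * y\<^sup>2 = hessian_form a d (1 *s P + y *s Q)"
      unfolding hessian_form_lincomb F0 A_def B_def by simp
    also have "\<dots> = c * (y * e) * (1 * - e) * (1 * (t2 * p1 - t1 * p2) + y * (t2 * q1 - t1 * q2))"
      unfolding hessian_form_on_section[OF H(9,5,6)] e_def by (simp add: algebra_simps)
    finally have "A * y + B * y\<^sup>2
        = c * (y * e) * (1 * - e) * (1 * (t2 * p1 - t1 * p2) + y * (t2 * q1 - t1 * q2))" .
    then show ?thesis by (simp add: algebra_simps power2_eq_square)
  qed
  then have "A + c * e\<^sup>2 * (t2 * p1 - t1 * p2) = 0" "B + c * e\<^sup>2 * (t2 * q1 - t1 * q2) = 0"
    using quadratic_eq_0(2,3)[OF infinite_UNIV_alg_closed] by blast+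
  then have AB: "A = - (c * e\<^sup>2 * (t2 * p1 - t1 * p2))" "B = - (c * e\<^sup>2 * (t2 * q1 - t1 * q2))"
    by (simp_all add: eq_neg_iff_add_eq_0)
  have "B *s P - A *s Q = - (c * e ^ 3) *s T"
    unfolding AB H(5-7) e_def by (simp add: vec3_eq_iff algebra_simps power2_eq_square power3_eq_cube)
  then show thesis using that[of "- (c * e ^ 3)"] e H(8) by (simp add: A_def B_def)
qed

text \<open>Comparison of the coefficients of y, y^2 and y^3 in the cubic at P + yw with those of
  the product having a double zero at \<open>P\<close>.\<close>

lemma tangent_line_section:
  fixes a :: "'a::alg_closed_field"
  assumes "P \<noteq> 0" "independent_pair u v" "P = p1 *s u + p2 *s v" "c \<noteq> 0"
    and F: "\<And>x y. hessian_form a d (x *s u + y *s v) =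
           c * (p2 * x - p1 * y) * (p2 * x - p1 * y) * (t2 * x - t1 * y)"
    and w: "w = w1 *s u + w2 *s v"
  shows "polar a d P w = 0" "polar a d w P = c * (p2 * w1 - p1 * w2)\<^sup>2 * (t2 * p1 - t1 * p2)"
    "hessian_form a d w = c * (p2 * w1 - p1 * w2)\<^sup>2 * (t2 * w1 - t1 * w2)"
proof -
  have P0: "hessian_form a d P = 0" using F[of p1 p2] assms(3) by (simp add: algebra_simps)
  define e where "e = p2 * w1 - p1 * w2"
  \<comment> \<open>The expansion has no constant term and is divided by y, so only nonzero y are
    available; an infinite set suffices.\<close>
  have "polar a d P w + (polar a d w P - c * e\<^sup>2 * (t2 * p1 - t1 * p2)) * y
      + (hessian_form a d w - c * e\<^sup>2 * (t2 * w1 - t1 * w2)) * y\<^sup>2 = 0" if "y \<in> - {0}" for y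
  proof -
    have "polar a d P w * y + polar a d w P * y\<^sup>2 + hessian_form a d w * y ^ 3
        = hessian_form a d (1 *s P + y *s w)"
      unfolding hessian_form_lincomb P0 by simp
    also have "\<dots> = c * (y * e) * (y * e) * (1 * (t2 * p1 - t1 * p2) + y * (t2 * w1 - t1 * w2))"
      unfolding hessian_form_on_section[OF F assms(3) w] e_def by (simp add: algebra_simps)
    finally have "y * (polar a d P w + (polar a d w P - c * e\<^sup>2 * (t2 * p1 - t1 * p2)) * y
      + (hessian_form a d w - c * e\<^sup>2 * (t2 * w1 - t1 * w2)) * y\<^sup>2) = 0"
      by (simp add: algebra_simps power2_eq_square power3_eq_cube)
    then show ?thesis using that by simp
  qed
  note quadratic_eq_0[OF infinite_nonzero this]
  then show "polar a d P w = 0" "polar a d w P = c * (p2 * w1 - p1 * w2)\<^sup>2 * (t2 * p1 - t1 * p2)"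
    "hessian_form a d w = c * (p2 * w1 - p1 * w2)\<^sup>2 * (t2 * w1 - t1 * w2)"
    unfolding e_def right_minus_eq by auto
qed

text \<open>For any second vector \<open>w\<close> on the tangent, the cubic at xP + yw is y^2 (Bx +
  Cy) with B = \<open>polar a d w P\<close> and C the value at \<open>w\<close>; the remaining root
  is (C : -B), which again does not involve \<open>T\<close>.\<close>

lemma third_point_tangent:
  fixes a :: "'a::alg_closed_field"
  assumes "line_section a d P P T" "independent_pair P w" "polar a d P w = 0"
    and grad: "hessian_gradient a d P \<noteq> 0"
  obtains k where "k \<noteq> 0" "hessian_form a d w *s P - polar a d w P *s w = k *s T"
  using assms(1)
proof (elim line_section_cases)
  fix u v p1 p2 q1 q2 t1 t2 c
  assume H: "P \<noteq> 0" "P \<noteq> 0" "T \<noteq> 0" "independent_pair u v"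
    "P = p1 *s u + p2 *s v" "P = q1 *s u + q2 *s v" "T = t1 *s u + t2 *s v" "c \<noteq> 0"
    "\<And>x y. hessian_form a d (x *s u + y *s v) =
           c * (p2 * x - p1 * y) * (q2 * x - q1 * y) * (t2 * x - t1 * y)"
  have q: "q1 = p1" "q2 = p2" using independent_pair_unique[OF H(4)] H(5,6) by metis+
  note F = H(9)[unfolded q]
  have u: "u = 1 *s u + 0 *s v" and v: "v = 0 *s u + 1 *s v" by (simp_all add: vec3_eq_iff)
  \<comment> \<open>As the gradient is nonzero, its orthogonal complement is only a plane; it
    contains \<open>u\<close> and \<open>v\<close>, hence is spanned by them.\<close>
  obtain w1 w2 where w: "w = w1 *s u + w2 *s v"
    using plane_lincomb[OF grad H(4)] assms(3) tangent_line_section(1)[OF H(1,4,5,8) F u]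
      tangent_line_section(1)[OF H(1,4,5,8) F v] unfolding polar_def by metis
  note t = tangent_line_section(2,3)[OF H(1,4,5,8) F w]
  define e where "e = p2 * w1 - p1 * w2"
  have e: "e \<noteq> 0" unfolding e_def by (rule independent_in_plane[OF H(5) w assms(2)])
  have "(c * e\<^sup>2 * (t2 * w1 - t1 * w2)) *s P - (c * e\<^sup>2 * (t2 * p1 - t1 * p2)) *s w = (c * e ^ 3) *s T"
    unfolding H(5) w H(7) e_def
    by (simp add: vec3_eq_iff algebra_simps power2_eq_square power3_eq_cube)
  then have "hessian_form a d w *s P - polar a d w P *s w = (c * e ^ 3) *s T"
    unfolding t e_def .
  then show thesis using that[of "c * e ^ 3"] e H(8) by simp
qed

text \<open>Both spanning vectors of the line lie on the tangent, and they cannot both be multiples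
  of \<open>P\<close>.\<close>

lemma tangent_direction_exists:
  fixes a :: "'a::alg_closed_field"
  assumes "line_section a d P P T"
  obtains w where "independent_pair P w" "polar a d P w = 0"
  using assms
proof (elim line_section_cases)
  fix u v p1 p2 q1 q2 t1 t2 c
  assume H: "P \<noteq> 0" "P \<noteq> 0" "T \<noteq> 0" "independent_pair u v"
    "P = p1 *s u + p2 *s v" "P = q1 *s u + q2 *s v" "T = t1 *s u + t2 *s v" "c \<noteq> 0"
    "\<And>x y. hessian_form a d (x *s u + y *s v) =
           c * (p2 * x - p1 * y) * (q2 * x - q1 * y) * (t2 * x - t1 * y)"
  have q: "q1 = p1" "q2 = p2" using independent_pair_unique[OF H(4)] H(5,6) by metis+
  note F = H(9)[unfolded q]
  have u: "u = 1 *s u + 0 *s v" and v: "v = 0 *s u + 1 *s v" by (simp_all add: vec3_eq_iff)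
  note T = tangent_line_section(1)[OF H(1,4,5,8) F]
  have "polar a d P u = 0" "polar a d P v = 0" using T u v by blast+
  moreover have "independent_pair P u \<or> independent_pair P v"
  proof (rule ccontr)
    assume "\<not> ?thesis"
    then obtain l m where lm: "u = l *s P" "v = m *s P"
      using proportional_or_independent[OF H(1)] by metis
    then have "m *s u + (- l) *s v = 0" by (simp only: vec3_eq_iff) (simp add: mult_ac)
    then have "m = 0" "l = 0" using independent_pairD[OF H(4), of m "- l"] by auto
    then have "u = 0" using lm(1) by (simp add: vec3_eq_iff)
    then show False using H(4) unfolding independent_pair_cross by simp
  qed
  ultimately show thesis using that by blast
qed

text \<open>Nonsingularity as conditions on the parameters: \<open>smooth_hessian_to_ac\<close>
  derives them, and \<open>gradient_not_0\<close> recovers the gradient condition from them.\<close>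

locale smooth_hessian =
  fixes a d :: "'a::alg_closed_field"
  assumes three: "(3::'a) \<noteq> 0" and a0: "a \<noteq> 0" and disc: "27 * a \<noteq> d ^ 3"
begin

abbreviation "E \<equiv> curve a d"

text \<open>Inversion on the curve: \<open>T\<close> and its swap differ by a multiple of (0, -1,
  1), so they are collinear with the identity.\<close>

definition neg :: "'a ^ 3 \<Rightarrow> 'a ^ 3" where
  "neg P = vector [P$1, P$3, P$2]"

lemma neg_nth [simp]: "neg P $ 1 = P $ 1" "neg P $ 2 = P $ 3" "neg P $ 3 = P $ 2"
  by (simp_all add: neg_def)

lemma neg_neg [simp]: "neg (neg P) = P"
  by (simp add: vec3_eq_iff)

lemma neg_scale: "neg (k *s P) = k *s neg P"
  by (simp add: vec3_eq_iff)

lemma neg_eq_0_iff [simp]: "neg P = 0 \<longleftrightarrow> P = 0"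
  by (auto simp: vec3_eq_iff)

lemma neg_curve [simp]: "neg P \<in> E \<longleftrightarrow> P \<in> E"
  by (simp add: curve_def hessian_form_def algebra_simps)

lemma origin_nth [simp]: "origin $ 1 = (0::'b::field)" "origin $ 2 = - (1::'b)" "origin $ 3 = (1::'b)"
  by (simp_all add: origin_def)

lemma curveD: "P \<in> E \<Longrightarrow> a * (P$1) ^ 3 + (P$2) ^ 3 + (P$3) ^ 3 = d * P$1 * P$2 * P$3"
  by (simp add: curve_def hessian_form_def)

lemma curve_not_0: "P \<in> E \<Longrightarrow> P $ 1 \<noteq> 0 \<or> P $ 2 \<noteq> 0 \<or> P $ 3 \<noteq> 0"
  by (auto simp: curve_def vec3_eq_iff)

text \<open>With m the common value, the curve equation reads 3m = dXYZ; cubing gives m^3 (27a -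
  d^3) = 0, so m and all coordinates vanish.\<close>

lemma cubes_not_equal:
  assumes "P \<in> E" "a * (P$1) ^ 3 = (P$2) ^ 3" "(P$2) ^ 3 = (P$3) ^ 3"
  shows False
proof -
  define m where "m = (P$2) ^ 3"
  have m: "P$2 ^ 3 = m" "P$3 ^ 3 = m" "a * P$1 ^ 3 = m" using assms m_def by simp_all
  have "3 * m = d * P$1 * P$2 * P$3" using curveD[OF assms(1)] m by simp
  then have "a * (3 * m) ^ 3 = a * (d * P$1 * P$2 * P$3) ^ 3" by simp
  also have "\<dots> = d ^ 3 * (a * P$1 ^ 3) * P$2 ^ 3 * P$3 ^ 3" by (simp add: power_mult_distrib)
  finally have "m ^ 3 * (27 * a - d ^ 3) = 0"
    unfolding m by (simp add: algebra_simps power3_eq_cube)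
  then have "m = 0" using disc by simp
  then show False using m a0 curve_not_0[OF assms(1)] by simp
qed

text \<open>Multiplying each partial derivative by its own variable turns a zero gradient into 3aX^3
  = 3Y^3 = 3Z^3.\<close>

lemma gradient_not_0:
  assumes "P \<in> E" shows "hessian_gradient a d P \<noteq> 0"
proof
  assume "hessian_gradient a d P = 0"
  then have g: "3 * a * (P$1)\<^sup>2 = d * P$2 * P$3" "3 * (P$2)\<^sup>2 = d * P$1 * P$3"
    "3 * (P$3)\<^sup>2 = d * P$1 * P$2"
    by (simp_all add: hessian_gradient_def vec3_eq_iff)
  have "3 * (a * P$1 ^ 3) = 3 * a * (P$1)\<^sup>2 * P$1" "3 * (P$2 ^ 3) = 3 * (P$2)\<^sup>2 * P$2"
    "3 * (P$3 ^ 3) = 3 * (P$3)\<^sup>2 * P$3"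
    by (simp_all add: power2_eq_square power3_eq_cube)
  then have "3 * (a * P$1 ^ 3) = 3 * (P$2 ^ 3)" "3 * (P$2 ^ 3) = 3 * (P$3 ^ 3)"
    unfolding g by (simp_all add: mult_ac)
  then show False using three cubes_not_equal[OF assms] by simp
qed

text \<open>The points with \<open>X = 0\<close> are flexes.\<close>
lemma flex_tangent:
  assumes "P \<in> E" "P$1 = 0" "Q \<in> E" "polar a d P Q = 0"
  shows "\<not> independent_pair P Q"
proof -
  have P: "P$2 ^ 3 = - (P$3 ^ 3)" using curveD[OF assms(1)] assms(2)
    by (simp add: eq_neg_iff_add_eq_0)
  then have nz: "P$2 \<noteq> 0" "P$3 \<noteq> 0" using curve_not_0[OF assms(1)] assms(2) by auto
  \<comment> \<open>With P = (0, Y, Z), the tangent at \<open>P\<close> is spanned by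
    \<open>P\<close> and (3Y, dZ, 0). The numbers \<open>l\<close> and \<open>b\<close> become the
    coordinates of \<open>Q\<close> in this basis, and the cubic at \<open>Q\<close> reduces to a
    nonzero multiple of b^3.\<close>
  define b where "b = Q$1 / (3 * P$2)"
  have q1: "Q$1 = 3 * P$2 * b" using nz three by (simp add: b_def)
  have "3 * ((P$2)\<^sup>2 * (Q$2 - d * P$3 * b) + (P$3)\<^sup>2 * Q$3) = 0"
    using assms(4) unfolding polar_eq assms(2) q1
    by (simp add: algebra_simps power2_eq_square)
  then have lin: "(P$2)\<^sup>2 * (Q$2 - d * P$3 * b) = - ((P$3)\<^sup>2 * Q$3)"
    using three unfolding eq_neg_iff_add_eq_0 mult_eq_0_iff by blast
  define l where "l = Q$3 / P$3"
  have q3: "Q$3 = l * P$3" using nz by (simp add: l_def)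
  have "(P$2)\<^sup>2 * (Q$2 - d * P$3 * b) = (P$2)\<^sup>2 * (l * P$2)"
    using lin P unfolding q3 by (simp add: power2_eq_square power3_eq_cube algebra_simps)
  then have "Q$2 - d * P$3 * b = l * P$2" using nz by simp
  then have q2: "Q$2 = l * P$2 + d * P$3 * b" by (simp add: diff_eq_eq)
  have Q: "a * (Q$1) ^ 3 + (Q$2) ^ 3 + (Q$3) ^ 3 - d * Q$1 * Q$2 * Q$3 = 0"
    using curveD[OF assms(3)] by simp
  have "a * (Q$1) ^ 3 + (Q$2) ^ 3 + (Q$3) ^ 3 - d * Q$1 * Q$2 * Q$3
      = b ^ 3 * (27 * a * P$2 ^ 3 + d ^ 3 * P$3 ^ 3) + l ^ 3 * (P$2 ^ 3 + P$3 ^ 3)"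
    unfolding q1 q2 q3 by (simp add: power3_eq_cube algebra_simps)
  with Q have "b ^ 3 * (27 * a * P$2 ^ 3 + d ^ 3 * P$3 ^ 3) + l ^ 3 * (P$2 ^ 3 + P$3 ^ 3) = 0"
    by (simp only:)
  moreover have "b ^ 3 * (27 * a * P$2 ^ 3 + d ^ 3 * P$3 ^ 3) + l ^ 3 * (P$2 ^ 3 + P$3 ^ 3)
      = - (b ^ 3 * P$3 ^ 3 * (27 * a - d ^ 3))"
    unfolding P by (simp add: algebra_simps)
  ultimately have "b ^ 3 * P$3 ^ 3 * (27 * a - d ^ 3) = 0" by simp
  then have "b = 0" using nz disc by simp
  then have "Q = l *s P" using q1 q2 q3 assms(2) by (simp add: vec3_eq_iff)
  then have "l *s P + (-1) *s Q = 0" by (simp add: vec3_eq_iff)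
  then show ?thesis unfolding independent_pair_def by (metis neg_equal_0_iff_equal one_neq_zero)
qed

text \<open>A line inside E would meet X = 0 in a point \<open>P\<close> of E and would lie in the
  tangent at \<open>P\<close>. But \<open>P\<close> is a flex, whose tangent meets E in
  \<open>P\<close> alone.\<close>

lemma no_line:
  assumes "independent_pair u v" shows "\<not> (\<forall>x y. hessian_form a d (x *s u + y *s v) = 0)"
proof
  assume all: "\<forall>x y. hessian_form a d (x *s u + y *s v) = 0"
  obtain x y where xy: "\<not> (x = 0 \<and> y = 0)" "x * u$1 + y * v$1 = 0"
    by (cases "u$1 = 0") (force intro: that[of 1 0], force intro: that[of "v$1" "- u$1"])
  define P where "P = x *s u + y *s v"
  have "P \<noteq> 0" using assms xy unfolding P_def independent_pair_def by blast
  then have P: "P \<in> E" "P$1 = 0" using all xy by (auto simp: P_def curve_def)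
  have on_line: "Q \<in> E \<and> polar a d P Q = 0" if Q: "Q = s *s u + t *s v" "Q \<noteq> 0" for Q s t
  proof -
    have F: "hessian_form a d Q = 0" using all Q by simp
    have "hessian_form a d (1 *s P + z *s Q) = 0" for z
    proof -
      have "1 *s P + z *s Q = (x + z * s) *s u + (y + z * t) *s v"
        unfolding Q P_def by (simp add: vec3_eq_iff algebra_simps)
      then show ?thesis using all by metis
    qed
    then have "0 + polar a d P Q * z + polar a d Q P * z\<^sup>2 = 0" for z
      using F P(1) unfolding hessian_form_lincomb by (simp add: curve_def algebra_simps)
    then have "polar a d P Q = 0"
      using quadratic_eq_0(2)[OF infinite_UNIV_alg_closed] by blast
    then show ?thesis using F Q by (simp add: curve_def)
  qed
  have "u \<noteq> 0" "v \<noteq> 0" using assms unfolding independent_pair_cross by auto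
  then have "\<not> independent_pair P u" "\<not> independent_pair P v"
    using on_line[of u 1 0] on_line[of v 0 1] flex_tangent[OF P] by (auto simp: vec3_eq_iff)
  then obtain l m where lm: "u = l *s P" "v = m *s P"
    using proportional_or_independent[OF \<open>P \<noteq> 0\<close>] by metis
  then have "m *s u + (- l) *s v = 0" by (simp only: vec3_eq_iff) (simp add: mult_ac)
  then have "m = 0" using independent_pairD[OF assms] by blast
  then show False using lm \<open>v \<noteq> 0\<close> by simp
qed

text \<open>For a chord and for a tangent alike, one vector built without \<open>T\<close> is a
  nonzero multiple of every possible third point. In the tangent case this requires one
  \<open>w\<close> for both sections.\<close>

lemma line_section_unique:
  assumes "line_section a d P Q T" "line_section a d P Q T'"
  obtains k where "k \<noteq> 0" "T' = k *s T"
proof -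
  have P: "P \<in> E" "Q \<in> E" "P \<noteq> 0" "Q \<noteq> 0"
    using line_section_curve1[OF assms(1)] line_section_curve2[OF assms(1)]
    by (auto simp: curve_def)
  have "\<exists>W k k'. k \<noteq> 0 \<and> k' \<noteq> 0 \<and> W = k *s T \<and> W = k' *s T'"
  proof (rule proportional_or_independent[OF P(3), of Q])
    assume "independent_pair P Q"
    then show ?thesis using assms third_point_secant by metis
  next
    fix l assume l: "Q = l *s P"
    then have "l \<noteq> 0" using P(4) by auto
    then have "P = (1 / l) *s Q" using l by (simp add: vec3_eq_iff)
    then have L: "line_section a d P P T" "line_section a d P P T'"
      using assms line_section_scale2[of a d P Q _ "1 / l"] \<open>l \<noteq> 0\<close> by auto
    obtain w where w: "independent_pair P w" "polar a d P w = 0"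
      using tangent_direction_exists[OF L(1)] .
    then show ?thesis using third_point_tangent[OF L(1) w gradient_not_0[OF P(1)]]
        third_point_tangent[OF L(2) w gradient_not_0[OF P(1)]] by metis
  qed
  then obtain k k' where k: "k \<noteq> 0" "k' \<noteq> 0" "k *s T = k' *s T'" by metis
  then have "T' = (k / k') *s T" by (simp add: vec3_eq_iff field_simps)
  then show thesis using that[of "k / k'"] k by simp
qed

text \<open>The converse of \<open>third_point_secant\<close>. The candidate is nonzero because
  otherwise the whole line PQ would lie on E.\<close>

lemma line_section_secant:
  assumes "P \<in> E" "Q \<in> E" "independent_pair P Q"
  shows "polar a d Q P *s P - polar a d P Q *s Q \<noteq> 0"
    "line_section a d P Q (polar a d Q P *s P - polar a d P Q *s Q)"
proof -
  define A B where "A = polar a d P Q" and "B = polar a d Q P"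
  have F: "hessian_form a d (x *s P + y *s Q) = - 1 * (0 * x - 1 * y) * (1 * x - 0 * y) * (- A * x - B * y) * - 1" for x y
    using assms(1,2) unfolding hessian_form_lincomb A_def B_def
    by (simp add: curve_def algebra_simps power2_eq_square)
  have "\<not> (A = 0 \<and> B = 0)" using no_line[OF assms(3)] F by auto
  then show nz: "polar a d Q P *s P - polar a d P Q *s Q \<noteq> 0"
    using assms(3) unfolding independent_pair_def A_def[symmetric] B_def[symmetric]
    by (metis add.inverse_inverse add_uminus_conv_diff neg_equal_0_iff_equal vector_sneg_minus1 vector_smult_lneg)
  show "line_section a d P Q (polar a d Q P *s P - polar a d P Q *s Q)"
    by (rule line_sectionI[of _ _ _ P Q 1 0 0 1 B "- A" 1])
      (use nz assms F in \<open>auto simp: A_def B_def curve_def vec3_eq_iff\<close>)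
qed

lemma line_section_origin:
  assumes "T \<in> E" shows "line_section a d origin T (neg T)"
proof (rule proportional_or_independent[of "origin :: 'a ^ 3" T])
  show "(origin :: 'a ^ 3) \<noteq> 0" by (simp add: vec3_eq_iff)
next
  assume ind: "independent_pair origin T"
  have O: "origin \<in> E" by (simp add: curve_def hessian_form_def vec3_eq_iff)
  \<comment> \<open>The chord formula with the identity as one point gives \<open>neg T\<close>
    times -A; the secant lemma makes this vector nonzero, so A can be divided out.\<close>
  define A where "A = d * T$1 + 3 * T$2 + 3 * T$3"
  have e: "polar a d T origin *s origin - polar a d origin T *s T = (- A) *s neg T"
    by (simp add: polar_eq A_def vec3_eq_iff algebra_simps power2_eq_square)
  with line_section_secant[OF O assms ind]
  have "(- A) *s neg T \<noteq> 0" "line_section a d origin T ((- A) *s neg T)" by simp_all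
  moreover from this have "A \<noteq> 0" by auto
  moreover have "(- 1 / A) *s (- A *s neg T) = neg T" using \<open>A \<noteq> 0\<close> by (simp add: vec3_eq_iff)
  ultimately show ?thesis using line_section_scale3[of a d origin T "- A *s neg T" "- 1 / A"] by simp
next
  fix l assume l: "T = l *s origin"
  then have l0: "l \<noteq> 0" using assms by (auto simp: curve_def)
  \<comment> \<open>A second vector on the tangent at the identity, whose gradient is (d, 3, 3). The
    restricted cubic is a pure multiple of y^3: the identity is a flex.\<close>
  define v :: "'a ^ 3" where "v = vector [3, - d, 0]"
  have v: "v$1 = 3" "v$2 = - d" "v$3 = 0" by (simp_all add: v_def)
  have "hessian_form a d (x *s origin + y *s v) = (27 * a - d ^ 3) * y ^ 3" for x y
    by (simp add: hessian_form_def v algebra_simps power3_eq_cube)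
  then have "\<And>x y. hessian_form a d (x *s origin + y *s v)
      = (27 * a - d ^ 3) / l\<^sup>2 * (0 * x - 1 * y) * (0 * x - l * y) * (0 * x - (- l) * y)"
    using l0 by (simp add: power2_eq_square power3_eq_cube)
  moreover have "independent_pair origin v"
    using three unfolding independent_pair_cross by (simp add: v)
  ultimately show ?thesis
    by (intro line_sectionI[of _ _ _ origin v 1 0 l 0 "- l" 0 "(27 * a - d ^ 3) / l\<^sup>2"])
      (use l l0 disc in \<open>auto simp: vec3_eq_iff\<close>)
qed

text \<open>The second line of the chord-tangent construction merely negates, so a sum amounts to a
  single collinearity condition on \<open>P\<close>, \<open>Q\<close> and the negative of
  \<open>S\<close>.\<close>

lemma is_sum_iff: "is_sum a d P Q S \<longleftrightarrow> line_section a d P Q (neg S)"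
proof
  assume "is_sum a d P Q S"
  then obtain T where T: "line_section a d P Q T" "line_section a d origin T S"
    unfolding is_sum_def by blast
  then obtain k where k: "k \<noteq> 0" "S = k *s neg T"
    using line_section_unique line_section_origin line_section_curve3 by metis
  then have "neg S = k *s T" by (simp add: neg_scale)
  then show "line_section a d P Q (neg S)" using T(1) k(1) line_section_scale3 by metis
next
  assume H: "line_section a d P Q (neg S)"
  then have "line_section a d origin (neg S) (neg (neg S))"
    using line_section_curve3 line_section_origin by blast
  then show "is_sum a d P Q S" using H unfolding is_sum_def by auto
qed

lemma is_sum_unique:
  assumes "is_sum a d P Q S" "is_sum a d P Q S'"
  obtains k where "k \<noteq> 0" "S' = k *s S"
  using assms line_section_unique[of P Q "neg S" "neg S'"] unfolding is_sum_iff
  by (metis neg_neg neg_scale)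

lemma is_sum_scale: "is_sum a d P Q S \<Longrightarrow> k \<noteq> 0 \<Longrightarrow> is_sum a d P Q (k *s S)"
  unfolding is_sum_iff neg_scale by (rule line_section_scale3)

lemma is_sum_unique_summand:
  assumes "is_sum a d P Q S" "is_sum a d P Q' S"
  obtains k where "k \<noteq> 0" "Q' = k *s Q"
  using assms line_section_unique[of P "neg S" Q Q'] line_section_swap23 unfolding is_sum_iff
  by metis

end

section \<open>Values of the three laws\<close>

definition law0_at :: "'a::comm_ring_1 ^ 3 \<Rightarrow> 'a ^ 3 \<Rightarrow> 'a ^ 3" where
  "law0_at P Q = vector
     [(P$1)\<^sup>2 * Q$2 * Q$3 - P$2 * P$3 * (Q$1)\<^sup>2,
      (P$3)\<^sup>2 * Q$1 * Q$2 - P$1 * P$2 * (Q$3)\<^sup>2,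
      (P$2)\<^sup>2 * Q$1 * Q$3 - P$1 * P$3 * (Q$2)\<^sup>2]"

definition law1_at :: "'a::comm_ring_1 \<Rightarrow> 'a ^ 3 \<Rightarrow> 'a ^ 3 \<Rightarrow> 'a ^ 3" where
  "law1_at a P Q = vector
     [P$1 * P$2 * (Q$2)\<^sup>2 - (P$3)\<^sup>2 * Q$1 * Q$3,
      a * P$1 * P$3 * (Q$1)\<^sup>2 - (P$2)\<^sup>2 * Q$2 * Q$3,
      P$2 * P$3 * (Q$3)\<^sup>2 - a * (P$1)\<^sup>2 * Q$1 * Q$2]"

definition law2_at :: "'a::comm_ring_1 \<Rightarrow> 'a ^ 3 \<Rightarrow> 'a ^ 3 \<Rightarrow> 'a ^ 3" where
  "law2_at a P Q = vector
     [P$1 * P$3 * (Q$3)\<^sup>2 - (P$2)\<^sup>2 * Q$1 * Q$2,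
      P$2 * P$3 * (Q$2)\<^sup>2 - a * (P$1)\<^sup>2 * Q$1 * Q$3,
      a * P$1 * P$2 * (Q$1)\<^sup>2 - (P$3)\<^sup>2 * Q$2 * Q$3]"

lemma law_at_nth [simp]:
  "law0_at P Q $ 1 = (P$1)\<^sup>2 * Q$2 * Q$3 - P$2 * P$3 * (Q$1)\<^sup>2"
  "law0_at P Q $ 2 = (P$3)\<^sup>2 * Q$1 * Q$2 - P$1 * P$2 * (Q$3)\<^sup>2"
  "law0_at P Q $ 3 = (P$2)\<^sup>2 * Q$1 * Q$3 - P$1 * P$3 * (Q$2)\<^sup>2"
  "law1_at a P Q $ 1 = P$1 * P$2 * (Q$2)\<^sup>2 - (P$3)\<^sup>2 * Q$1 * Q$3"
  "law1_at a P Q $ 2 = a * P$1 * P$3 * (Q$1)\<^sup>2 - (P$2)\<^sup>2 * Q$2 * Q$3"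
  "law1_at a P Q $ 3 = P$2 * P$3 * (Q$3)\<^sup>2 - a * (P$1)\<^sup>2 * Q$1 * Q$2"
  "law2_at a P Q $ 1 = P$1 * P$3 * (Q$3)\<^sup>2 - (P$2)\<^sup>2 * Q$1 * Q$2"
  "law2_at a P Q $ 2 = P$2 * P$3 * (Q$2)\<^sup>2 - a * (P$1)\<^sup>2 * Q$1 * Q$3"
  "law2_at a P Q $ 3 = a * P$1 * P$2 * (Q$1)\<^sup>2 - (P$3)\<^sup>2 * Q$2 * Q$3"
  by (simp_all add: law0_at_def law1_at_def law2_at_def)

definition laws_at :: "'a::comm_ring_1 \<Rightarrow> 'a ^ 3 \<Rightarrow> 'a ^ 3 \<Rightarrow> ('a ^ 3) set" where
  "laws_at a P Q = {law0_at P Q, law1_at a P Q, law2_at a P Q}"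

lemma proportional_if_minors_zero:
  fixes S W :: "'a::field ^ 3"
  assumes "W \<noteq> 0" "S$1 * W$2 = S$2 * W$1" "S$1 * W$3 = S$3 * W$1" "S$2 * W$3 = S$3 * W$2"
  obtains l where "S = l *s W"
proof -
  from assms(1) obtain j where j: "W $ j \<noteq> 0" by (auto simp: vec_eq_iff)
  have "S $ i * W $ j = S $ j * W $ i" for i
    using assms(2-4) exhaust_3[of i] exhaust_3[of j] by auto
  then have "S = (S $ j / W $ j) *s W" using j by (simp add: vec_eq_iff field_simps)
  then show thesis using that by blast
qed

text \<open>The cofactors come from division with remainder by the two curve equations.\<close>
lemma law_minors:
  fixes a d :: "'a::field"
  shows
  "law0_at P Q $ 1 * law1_at a P Q $ 2 - law0_at P Q $ 2 * law1_at a P Q $ 1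
    = (P$3 * (Q$1)^2 * Q$2 * Q$3) * hessian_form a d P
      + (- P$1 * P$2 * (P$3)^2 * Q$1) * hessian_form a d Q"
  "law0_at P Q $ 1 * law1_at a P Q $ 3 - law0_at P Q $ 3 * law1_at a P Q $ 1
    = (- P$1 * Q$1 * (Q$2)^2 * Q$3) * hessian_form a d P
      + ((P$1)^2 * P$2 * P$3 * Q$2) * hessian_form a d Q"
  "law0_at P Q $ 2 * law1_at a P Q $ 3 - law0_at P Q $ 3 * law1_at a P Q $ 2
    = (P$2 * Q$1 * Q$2 * (Q$3)^2) * hessian_form a d P
      + (- P$1 * (P$2)^2 * P$3 * Q$3) * hessian_form a d Q"
  "law0_at P Q $ 1 * law2_at a P Q $ 2 - law0_at P Q $ 2 * law2_at a P Q $ 1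
    = (- P$1 * Q$1 * Q$2 * (Q$3)^2) * hessian_form a d P
      + ((P$1)^2 * P$2 * P$3 * Q$3) * hessian_form a d Q"
  "law0_at P Q $ 1 * law2_at a P Q $ 3 - law0_at P Q $ 3 * law2_at a P Q $ 1
    = (P$2 * (Q$1)^2 * Q$2 * Q$3) * hessian_form a d P
      + (- P$1 * (P$2)^2 * P$3 * Q$1) * hessian_form a d Q"
  "law0_at P Q $ 2 * law2_at a P Q $ 3 - law0_at P Q $ 3 * law2_at a P Q $ 2
    = (- P$3 * Q$1 * (Q$2)^2 * Q$3) * hessian_form a d P
      + (P$1 * P$2 * (P$3)^2 * Q$2) * hessian_form a d Q"
  "law1_at a P Q $ 1 * law2_at a P Q $ 2 - law1_at a P Q $ 2 * law2_at a P Q $ 1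
    = (- P$2 * Q$1 * (Q$2)^2 * Q$3) * hessian_form a d P
      + (P$1 * (P$2)^2 * P$3 * Q$2) * hessian_form a d Q"
  "law1_at a P Q $ 1 * law2_at a P Q $ 3 - law1_at a P Q $ 3 * law2_at a P Q $ 1
    = (P$3 * Q$1 * Q$2 * (Q$3)^2) * hessian_form a d P
      + (- P$1 * P$2 * (P$3)^2 * Q$3) * hessian_form a d Q"
  "law1_at a P Q $ 2 * law2_at a P Q $ 3 - law1_at a P Q $ 3 * law2_at a P Q $ 2
    = (- a * P$1 * (Q$1)^2 * Q$2 * Q$3) * hessian_form a d P
      + (a * (P$1)^2 * P$2 * P$3 * Q$1) * hessian_form a d Q"
  by (simp_all add: hessian_form_def algebra_simps power2_eq_square power3_eq_cube)

text \<open>A polynomial identity, valid without the curve equations. \<open>N\<close> is the third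
  point on the chord; exchanging its last two coordinates is the negation that turns it into the
  sum.\<close>

lemma secant_eq_laws:
  fixes a d :: "'a::field"
  assumes "W = (3 *s law1_at a P Q + 3 *s law2_at a P Q) - d *s law0_at P Q"
    and "N = polar a d Q P *s P - polar a d P Q *s Q"
  shows "W $ 1 = N $ 1" "W $ 2 = N $ 3" "W $ 3 = N $ 2"
  unfolding assms
  by (simp_all add: polar_eq algebra_simps power2_eq_square)

context smooth_hessian
begin

lemma laws_proportional:
  assumes "P \<in> E" "Q \<in> E" "S \<in> laws_at a P Q" "T \<in> laws_at a P Q"
  shows "S$1 * T$2 = S$2 * T$1" "S$1 * T$3 = S$3 * T$1" "S$2 * T$3 = S$3 * T$2"
proof -
  have F: "hessian_form a d P = 0" "hessian_form a d Q = 0"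
    using assms(1,2) by (simp_all add: curve_def)
  note m = law_minors[where P = P and Q = Q and a = a and d = d, unfolded F mult_zero_right add_0]
  have "S$1 * T$2 - S$2 * T$1 = 0 \<and> S$1 * T$3 - S$3 * T$1 = 0 \<and> S$2 * T$3 - S$3 * T$2 = 0"
    using assms(3,4) m unfolding laws_at_def
    by (elim insertE emptyE) (simp_all only: right_minus_eq mult.commute simp_thms)
  then show "S$1 * T$2 = S$2 * T$1" "S$1 * T$3 = S$3 * T$1" "S$2 * T$3 = S$3 * T$2"
    by simp_all
qed

text \<open>The chord vector is a nonzero combination of the three values, so not all of them
  vanish. Each value is proportional to the other two, hence to the chord vector.\<close>

lemma is_sum_laws_independent:
  assumes "P \<in> E" "Q \<in> E" "independent_pair P Q"
  shows "\<exists>S\<in>laws_at a P Q. S \<noteq> 0" "S \<in> laws_at a P Q \<Longrightarrow> S \<noteq> 0 \<Longrightarrow> is_sum a d P Q S"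
proof -
  define N where "N = polar a d Q P *s P - polar a d P Q *s Q"
  define W where "W = (3 *s law1_at a P Q + 3 *s law2_at a P Q) - d *s law0_at P Q"
  have "W = neg N" using secant_eq_laws[OF W_def N_def] by (simp add: vec3_eq_iff)
  moreover have "N \<noteq> 0" "line_section a d P Q N"
    using line_section_secant[OF assms] unfolding N_def by blast+
  ultimately have W: "W \<noteq> 0" "is_sum a d P Q W" unfolding is_sum_iff by auto
  show "\<exists>S\<in>laws_at a P Q. S \<noteq> 0"
  proof (rule ccontr)
    assume "\<not> ?thesis"
    then have "W = 0" unfolding W_def laws_at_def by (auto simp: vec_eq_iff)
    then show False using W(1) by simp
  qed
  assume S: "S \<in> laws_at a P Q" "S \<noteq> 0"
  have m: "S$1 * W$2 = S$2 * W$1" "S$1 * W$3 = S$3 * W$1" "S$2 * W$3 = S$3 * W$2"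
  proof -
    have e: "S$i * W$j - S$j * W$i
        = 3 * (S$i * law1_at a P Q $ j - S$j * law1_at a P Q $ i)
          + 3 * (S$i * law2_at a P Q $ j - S$j * law2_at a P Q $ i)
          - d * (S$i * law0_at P Q $ j - S$j * law0_at P Q $ i)" for i j
      unfolding W_def by (simp del: law_at_nth add: algebra_simps)
    have z: "S$i * T $ j - S$j * T $ i = 0"
      if "T \<in> laws_at a P Q" "(i, j) \<in> {(1,2),(1,3),(2,3)}" for i j T
      using that laws_proportional[OF assms(1,2) S(1) that(1)] by auto
    have "law0_at P Q \<in> laws_at a P Q" "law1_at a P Q \<in> laws_at a P Q"
      "law2_at a P Q \<in> laws_at a P Q"
      by (simp_all add: laws_at_def)
    note z = this[THEN z]
    have "S$i * W$j - S$j * W$i = 0" if "(i, j) \<in> {(1,2),(1,3),(2,3)}" for i j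
      unfolding e z[OF that] by simp
    from this[of 1 2] this[of 1 3] this[of 2 3]
    show "S$1 * W$2 = S$2 * W$1" "S$1 * W$3 = S$3 * W$1" "S$2 * W$3 = S$3 * W$2"
      by simp_all
  qed
  obtain l where l: "S = l *s W" using proportional_if_minors_zero[OF W(1) m] .
  then have "l \<noteq> 0" using S(2) by auto
  then show "is_sum a d P Q S" using l W(2) is_sum_scale by blast
qed

text \<open>The value of the second law on the diagonal; the first law vanishes there and the third
  gives the opposite vector, see \<open>laws_at_proportional_pair\<close>.\<close>

definition doubling :: "'a ^ 3 \<Rightarrow> 'a ^ 3" where
  "doubling P = vector [P$1 * (P$2 ^ 3 - P$3 ^ 3), P$3 * (a * P$1 ^ 3 - P$2 ^ 3), P$2 * (P$3 ^ 3 - a * P$1 ^ 3)]"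

lemma doubling_nth [simp]:
  "doubling P $ 1 = P$1 * (P$2 ^ 3 - P$3 ^ 3)" "doubling P $ 2 = P$3 * (a * P$1 ^ 3 - P$2 ^ 3)"
  "doubling P $ 3 = P$2 * (P$3 ^ 3 - a * P$1 ^ 3)"
  by (simp_all add: doubling_def)

lemma laws_at_proportional_pair:
  "law0_at P (l *s P) = 0" "law1_at a P (l *s P) = l\<^sup>2 *s doubling P"
  "law2_at a P (l *s P) = - l\<^sup>2 *s doubling P"
  by (simp_all add: vec3_eq_iff algebra_simps power2_eq_square power3_eq_cube)

text \<open>If no coordinate of \<open>P\<close> is zero, vanishing forces the equal cubes excluded
  by \<open>cubes_not_equal\<close>. If one is zero, the curve equation makes all of them
  zero.\<close>

lemma doubling_not_0:
  assumes "P \<in> E" shows "doubling P \<noteq> 0"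
proof
  assume "doubling P = 0"
  then have D: "P$1 = 0 \<or> P$2 ^ 3 = P$3 ^ 3" "P$3 = 0 \<or> a * P$1 ^ 3 = P$2 ^ 3"
    "P$2 = 0 \<or> P$3 ^ 3 = a * P$1 ^ 3"
    by (auto simp: vec3_eq_iff)
  show False
  proof (cases "P$1 = 0 \<or> P$2 = 0 \<or> P$3 = 0")
    case True
    then show False using D curveD[OF assms] curve_not_0[OF assms] a0
      by (elim disjE) (auto simp: eq_neg_iff_add_eq_0)
  next
    case False
    then show False using D cubes_not_equal[OF assms] by auto
  qed
qed

text \<open>The points with XYZ = 0 are flexes. In each case the tangent contains an explicit
  \<open>v\<close> for which both mixed terms vanish, so the cubic at xP + yv is y^3 times its value
  at \<open>v\<close>; up to sign that value is a nonzero cube times 27a - d^3.\<close>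

lemma line_section_flex:
  assumes "P \<in> E" "P$1 = 0 \<or> P$2 = 0 \<or> P$3 = 0"
  shows "line_section a d P P P"
proof -
  have e: "a * P$1 ^ 3 + P$2 ^ 3 + P$3 ^ 3 = 0" using curveD[OF assms(1)] assms(2) by auto
  have "\<exists>v. independent_pair P v \<and> polar a d P v = 0 \<and> polar a d v P = 0 \<and> hessian_form a d v \<noteq> 0"
  proof (cases "P$1 = 0")
    case True
    define v :: "'a ^ 3" where "v = vector [3 * P$2, d * P$3, 0]"
    have v: "v$1 = 3 * P$2" "v$2 = d * P$3" "v$3 = 0" by (simp_all add: v_def)
    have nz: "P$2 \<noteq> 0" "P$3 \<noteq> 0" and e3: "P$3 ^ 3 = - (P$2 ^ 3)"
      using curve_not_0[OF assms(1)] e True by (auto simp: eq_neg_iff_add_eq_0 add.commute)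
    have "hessian_form a d v = P$2 ^ 3 * (27 * a) + d ^ 3 * P$3 ^ 3"
      unfolding hessian_form_def v by (simp add: power3_eq_cube)
    also have "\<dots> = P$2 ^ 3 * (27 * a - d ^ 3)" unfolding e3 by (simp add: algebra_simps)
    finally have "hessian_form a d v \<noteq> 0" using nz disc by simp
    moreover have "independent_pair P v" unfolding independent_pair_cross v True using nz three by simp
    moreover have "polar a d P v = 0" "polar a d v P = 0"
      unfolding polar_eq v True by (simp_all add: algebra_simps power2_eq_square)
    ultimately show ?thesis by blast
  next
    case X: False
    show ?thesis
    proof (cases "P$2 = 0")
      case True
      define v :: "'a ^ 3" where "v = vector [0, 3 * P$3, d * P$1]"
      have v: "v$1 = 0" "v$2 = 3 * P$3" "v$3 = d * P$1" by (simp_all add: v_def)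
      have e3: "P$3 ^ 3 = - (a * P$1 ^ 3)"
        using e True by (simp add: eq_neg_iff_add_eq_0 add.commute)
      have "hessian_form a d v = 27 * P$3 ^ 3 + d ^ 3 * P$1 ^ 3"
        unfolding hessian_form_def v by (simp add: power3_eq_cube)
      also have "\<dots> = P$1 ^ 3 * (d ^ 3 - 27 * a)" unfolding e3 by (simp add: algebra_simps)
      finally have "hessian_form a d v \<noteq> 0" using X disc by simp
      moreover have "P$3 \<noteq> 0" using e3 X a0 by auto
      then have "independent_pair P v" unfolding independent_pair_cross v True using X three by simp
      moreover have "polar a d P v = 0" "polar a d v P = 0"
        unfolding polar_eq v True by (simp_all add: algebra_simps power2_eq_square)
      ultimately show ?thesis by blast
    next
      case False
      then have Z: "P$3 = 0" using assms(2) X by simp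
      define v :: "'a ^ 3" where "v = vector [0, d * P$1, 3 * P$2]"
      have v: "v$1 = 0" "v$2 = d * P$1" "v$3 = 3 * P$2" by (simp_all add: v_def)
      have e3: "P$2 ^ 3 = - (a * P$1 ^ 3)"
        using e Z by (simp add: eq_neg_iff_add_eq_0 add.commute)
      have "hessian_form a d v = 27 * P$2 ^ 3 + d ^ 3 * P$1 ^ 3"
        unfolding hessian_form_def v by (simp add: power3_eq_cube)
      also have "\<dots> = P$1 ^ 3 * (d ^ 3 - 27 * a)" unfolding e3 by (simp add: algebra_simps)
      finally have "hessian_form a d v \<noteq> 0" using X disc by simp
      moreover have "independent_pair P v" unfolding independent_pair_cross v Z using X False three by simp
      moreover have "polar a d P v = 0" "polar a d v P = 0"
        unfolding polar_eq v Z by (simp_all add: algebra_simps power2_eq_square)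
      ultimately show ?thesis by blast
    qed
  qed
  then obtain v where v: "independent_pair P v" "polar a d P v = 0" "polar a d v P = 0"
    "hessian_form a d v \<noteq> 0" by blast
  have "hessian_form a d (x *s P + y *s v)
      = - hessian_form a d v * (0 * x - 1 * y) * (0 * x - 1 * y) * (0 * x - 1 * y)" for x y
    using assms(1) unfolding hessian_form_lincomb v(2,3) curve_def by (simp add: power3_eq_cube)
  then show ?thesis
    using assms(1) v by (intro line_sectionI[of P P P P v 1 0 1 0 1 0 "- hessian_form a d v"])
      (auto simp: curve_def vec3_eq_iff)
qed

text \<open>\<open>N\<close> lies on the tangent identically in \<open>P\<close>, and the cubic at
  \<open>N\<close> is a multiple of the cubic at \<open>P\<close>. If \<open>N\<close> is another
  point, the restricted cubic is y^2 x times a factor that \<open>no_line\<close> keeps nonzero; if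
  \<open>N\<close> is the same point, \<open>P\<close> is a flex.\<close>

lemma is_sum_doubling:
  assumes "P \<in> E" shows "is_sum a d P P (doubling P)"
proof -
  define N where "N = neg (doubling P)"
  have N: "N$1 = P$1 * (P$2 ^ 3 - P$3 ^ 3)" "N$2 = P$2 * (P$3 ^ 3 - a * P$1 ^ 3)"
    "N$3 = P$3 * (a * P$1 ^ 3 - P$2 ^ 3)"
    by (simp_all add: N_def)
  have N0: "N \<noteq> 0" using doubling_not_0[OF assms] by (simp add: N_def)
  have P0: "P \<noteq> 0" using assms by (simp add: curve_def)
  have "line_section a d P P N"
  proof (rule proportional_or_independent[OF P0, of N])
    assume ind: "independent_pair P N"
    have tangent: "polar a d P N = 0"
      unfolding polar_eq N by (simp add: algebra_simps power2_eq_square power3_eq_cube)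
    have "hessian_form a d N = (P$2 ^ 3 - P$3 ^ 3) * (P$3 ^ 3 - a * P$1 ^ 3) * (a * P$1 ^ 3 - P$2 ^ 3)
        * hessian_form a d P"
      unfolding hessian_form_def N by (simp add: algebra_simps power3_eq_cube)
    then have "hessian_form a d N = 0" using assms by (simp add: curve_def)
    then have F: "hessian_form a d (x *s P + y *s N)
        = polar a d N P * (0 * x - 1 * y) * (0 * x - 1 * y) * (1 * x - 0 * y)" for x y
      using assms unfolding hessian_form_lincomb tangent curve_def
      by (simp add: power2_eq_square mult_ac)
    have "polar a d N P \<noteq> 0"
      using no_line[OF ind] F by auto
    then show ?thesis
      using ind F N0 P0 by (intro line_sectionI[of P P N P N 1 0 1 0 0 1 "polar a d N P"])
        (auto simp: vec3_eq_iff)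
  next
    fix l assume l: "N = l *s P"
    then have l0: "l \<noteq> 0" using N0 by auto
    have "P$1 = 0 \<or> P$2 = 0 \<or> P$3 = 0"
    proof (rule ccontr)
      assume nz: "\<not> ?thesis"
      have "P$1 * (P$2 ^ 3 - P$3 ^ 3) = P$1 * l" "P$2 * (P$3 ^ 3 - a * P$1 ^ 3) = P$2 * l"
        "P$3 * (a * P$1 ^ 3 - P$2 ^ 3) = P$3 * l"
        unfolding N[symmetric] l by (simp_all add: mult.commute)
      then have e: "P$2 ^ 3 - P$3 ^ 3 = l" "P$3 ^ 3 - a * P$1 ^ 3 = l" "a * P$1 ^ 3 - P$2 ^ 3 = l"
        using nz unfolding mult_cancel_left by blast+
      \<comment> \<open>The three cofactors in the coordinates of \<open>N\<close> sum to zero, so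
        they cannot share a nonzero value when 3 is invertible.\<close>
      have "3 * l = (P$2 ^ 3 - P$3 ^ 3) + (P$3 ^ 3 - a * P$1 ^ 3) + (a * P$1 ^ 3 - P$2 ^ 3)"
        unfolding e by simp
      also have "\<dots> = 0" by simp
      finally show False using l0 three by simp
    qed
    then show ?thesis using line_section_flex[OF assms] line_section_scale3 l l0 by blast
  qed
  then show ?thesis unfolding is_sum_iff N_def .
qed

lemma laws_at_not_all_0:
  assumes "P \<in> E" "Q \<in> E" obtains S where "S \<in> laws_at a P Q" "S \<noteq> 0"
proof (rule proportional_or_independent[of P Q])
  show "P \<noteq> 0" using assms by (simp add: curve_def)
next
  assume "independent_pair P Q"
  then show thesis using is_sum_laws_independent(1)[OF assms] that by blast
next
  fix l assume l: "Q = l *s P"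
  then have "l \<noteq> 0" using assms by (auto simp: curve_def)
  then have "law1_at a P Q \<noteq> 0"
    unfolding l laws_at_proportional_pair using doubling_not_0[OF assms(1)]
    by (simp add: vec3_scale_eq_0_iff)
  then show thesis using that unfolding laws_at_def by blast
qed

lemma is_sum_laws:
  assumes "P \<in> E" "Q \<in> E" "S \<in> laws_at a P Q" "S \<noteq> 0"
  shows "is_sum a d P Q S"
proof (rule proportional_or_independent[of P Q])
  show "P \<noteq> 0" using assms by (simp add: curve_def)
next
  assume "independent_pair P Q"
  then show ?thesis using is_sum_laws_independent(2) assms by blast
next
  fix l assume l: "Q = l *s P"
  then have l0: "l \<noteq> 0" using assms by (auto simp: curve_def)
  have "S \<in> {0, l\<^sup>2 *s doubling P, - l\<^sup>2 *s doubling P}"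
    using assms(3) unfolding l laws_at_def laws_at_proportional_pair .
  then obtain m where "m \<noteq> 0" "S = m *s doubling P" using assms(4) l0
    by (metis insertE power_not_zero neg_equal_0_iff_equal singletonD)
  moreover have "is_sum a d P Q (doubling P)"
    using is_sum_doubling[OF assms(1)] line_section_scale2[OF _ l0] unfolding is_sum_iff l by blast
  ultimately show ?thesis using is_sum_scale by blast
qed

text \<open>Some law is nonzero at every pair of points, so common vanishing of the three first
  coordinates detects X(P + Q) = 0. Every addition law then has first coordinate zero there.\<close>

lemma is_sum_X0:
  assumes "P \<in> E" "Q \<in> E" "\<forall>S\<in>laws_at a P Q. S $ 1 = 0" "is_sum a d P Q T"
  shows "T $ 1 = 0"
proof -
  obtain S where "S \<in> laws_at a P Q" "S \<noteq> 0" using laws_at_not_all_0[OF assms(1,2)] .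
  then show ?thesis
    using is_sum_unique[OF is_sum_laws[OF assms(1,2)] assms(4)] assms(3) by (metis mult_zero_right vector_smult_component)
qed

end

section \<open>Evaluation of polynomials of bidegree (2,2)\<close>

definition monomial_at :: "(3 + 3 \<Rightarrow> 'b::comm_semiring_1) \<Rightarrow> (3 + 3 \<Rightarrow>\<^sub>0 nat) \<Rightarrow> 'b" where
  "monomial_at v m = (\<Prod>x\<in>UNIV. v x ^ Poly_Mapping.lookup m x)"

lemma monomial_at_0 [simp]: "monomial_at v 0 = 1"
  by (simp add: monomial_at_def)

lemma monomial_at_add: "monomial_at v (m + n) = monomial_at v m * monomial_at v n"
  by (simp add: monomial_at_def lookup_add power_add prod.distrib)

lemma monomial_at_single [simp]: "monomial_at v (Poly_Mapping.single x 1) = v x"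
proof -
  have "monomial_at v (Poly_Mapping.single x 1) = (\<Prod>y\<in>UNIV. if y = x then v x else 1)"
    unfolding monomial_at_def by (intro prod.cong) (auto simp: lookup_single when_def)
  then show ?thesis by simp
qed

lemma poly_mapping_eq_sum_single:
  "p = (\<Sum>m\<in>Poly_Mapping.keys p. Poly_Mapping.single m (Poly_Mapping.lookup p m))"
proof (rule poly_mapping_eqI)
  fix k
  have "Poly_Mapping.lookup (\<Sum>m\<in>Poly_Mapping.keys p. Poly_Mapping.single m (Poly_Mapping.lookup p m)) k
      = (\<Sum>m\<in>Poly_Mapping.keys p. if m = k then Poly_Mapping.lookup p k else 0)"
    unfolding lookup_sum by (intro sum.cong) (auto simp: lookup_single when_def)
  also have "\<dots> = Poly_Mapping.lookup p k" by (simp add: in_keys_iff)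
  finally show "Poly_Mapping.lookup p k = Poly_Mapping.lookup
      (\<Sum>m\<in>Poly_Mapping.keys p. Poly_Mapping.single m (Poly_Mapping.lookup p m)) k" by simp
qed

text \<open>Substitution is needed with two coefficient maps: the identity for values over the
  closure, and \<open>to_ac\<close> to evaluate a polynomial over k without forming its base
  change.\<close>

locale coefficient_hom =
  fixes h :: "'a::comm_ring_1 \<Rightarrow> 'b::comm_ring_1"
  assumes h_0: "h 0 = 0" and h_1: "h 1 = 1"
    and h_add: "h (x + y) = h x + h y" and h_mult: "h (x * y) = h x * h y"
begin

lemma subst_poly_superset:
  assumes "finite A" "Poly_Mapping.keys p \<subseteq> A"
  shows "subst_poly h v p = (\<Sum>m\<in>A. h (Poly_Mapping.lookup p m) * monomial_at v m)"
  unfolding subst_poly_def monomial_at_def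
  by (rule sum.mono_neutral_left[OF assms]) (auto simp: in_keys_iff h_0)

lemma subst_poly_add [simp]: "subst_poly h v (p + q) = subst_poly h v p + subst_poly h v q"
proof -
  let ?A = "Poly_Mapping.keys p \<union> Poly_Mapping.keys q"
  have "subst_poly h v p = (\<Sum>m\<in>?A. h (Poly_Mapping.lookup p m) * monomial_at v m)"
    "subst_poly h v q = (\<Sum>m\<in>?A. h (Poly_Mapping.lookup q m) * monomial_at v m)"
    "subst_poly h v (p + q) = (\<Sum>m\<in>?A. h (Poly_Mapping.lookup (p + q) m) * monomial_at v m)"
    by (rule subst_poly_superset; use keys_add[of p q] in auto)+
  then show ?thesis by (simp add: lookup_add h_add algebra_simps sum.distrib)
qed

lemma subst_poly_0 [simp]: "subst_poly h v 0 = 0"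
  by (simp add: subst_poly_def)

lemma subst_poly_sum: "subst_poly h v (sum f A) = (\<Sum>x\<in>A. subst_poly h v (f x))"
  by (induction A rule: infinite_finite_induct) simp_all

lemma subst_poly_single: "subst_poly h v (Poly_Mapping.single m c) = h c * monomial_at v m"
  by (cases "c = 0") (simp_all add: subst_poly_def monomial_at_def h_0)

lemma subst_poly_mult [simp]: "subst_poly h v (p * q) = subst_poly h v p * subst_poly h v q"
proof -
  let ?t = "\<lambda>p m. Poly_Mapping.single m (Poly_Mapping.lookup p m)"
  have "p * q = (\<Sum>m\<in>Poly_Mapping.keys p. \<Sum>n\<in>Poly_Mapping.keys q. ?t p m * ?t q n)"
    by (subst (1) poly_mapping_eq_sum_single[of p], subst (1) poly_mapping_eq_sum_single[of q])
      (rule sum_product)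
  then have "subst_poly h v (p * q) = (\<Sum>m\<in>Poly_Mapping.keys p. \<Sum>n\<in>Poly_Mapping.keys q.
      (h (Poly_Mapping.lookup p m) * monomial_at v m) * (h (Poly_Mapping.lookup q n) * monomial_at v n))"
    by (simp add: subst_poly_sum mult_single subst_poly_single monomial_at_add h_mult mult_ac)
  also have "\<dots> = subst_poly h v p * subst_poly h v q"
    unfolding sum_product[symmetric] by (simp add: subst_poly_def monomial_at_def)
  finally show ?thesis .
qed

lemma subst_poly_Const [simp]: "subst_poly h v (Const c) = h c"
  by (simp add: Const_def subst_poly_single)

lemma subst_poly_1 [simp]: "subst_poly h v 1 = 1"
  using subst_poly_Const[of v 1] by (simp add: Const_def h_1)

lemma subst_poly_Var [simp]: "subst_poly h v (Var x) = v x"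
  by (simp only: Var_def subst_poly_single monomial_at_single h_1 mult_1_left)

lemma subst_poly_diff [simp]: "subst_poly h v (p - q) = subst_poly h v p - subst_poly h v q"
  using subst_poly_add[of v "p - q" q] by simp

lemma subst_poly_power [simp]: "subst_poly h v (p ^ n) = subst_poly h v p ^ n"
  by (induction n) simp_all

lemma subst_poly_prod: "subst_poly h v (prod f A) = (\<Prod>x\<in>A. subst_poly h v (f x))"
  by (induction A rule: infinite_finite_induct) simp_all

end

interpretation coefficient_id: coefficient_hom "\<lambda>c. c"
  by unfold_locales simp_all

interpretation coefficient_ac: coefficient_hom to_ac
  by unfold_locales simp_all

lemma eval_at_base_change:
  "eval_at P Q (base_change p) = subst_poly to_ac (case_sum (($) P) (($) Q)) p"
proof -
  have "Poly_Mapping.lookup (base_change p) m = to_ac (Poly_Mapping.lookup p m)" for m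
    by (simp add: base_change_def Poly_Mapping.map.rep_eq when_def)
  moreover from this have "Poly_Mapping.keys (base_change p) = Poly_Mapping.keys p"
    by (auto simp: in_keys_iff)
  ultimately show ?thesis unfolding eval_at_def subst_poly_def by simp
qed

lemma eval_at_subst_poly:
  fixes p :: "'a::comm_ring_1 bipoly"
  shows "eval_at P Q (subst_poly Const V p) = subst_poly (\<lambda>c. c) (\<lambda>x. eval_at P Q (V x)) p"
proof -
  define e where "e = eval_at P Q"
  have e: "e = subst_poly (\<lambda>c. c) (case_sum (($) P) (($) Q))" by (simp add: e_def eval_at_def)
  have "e (subst_poly Const V p) = (\<Sum>m\<in>Poly_Mapping.keys p. Poly_Mapping.lookup p m *
      (\<Prod>x\<in>UNIV. e (V x) ^ Poly_Mapping.lookup m x))"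
    unfolding e subst_poly_def[of Const]
    by (simp add: coefficient_id.subst_poly_sum coefficient_id.subst_poly_prod)
  then show ?thesis unfolding e_def[symmetric] by (simp add: subst_poly_def)
qed

definition value_at :: "'a::field alg_closure ^ 3 \<Rightarrow> 'a alg_closure ^ 3 \<Rightarrow> 'a bipoly ^ 3 \<Rightarrow> 'a alg_closure ^ 3" where
  "value_at P Q s = eval3_at P Q (base_change3 s)"

lemma value_at_nth: "value_at P Q s $ i = subst_poly to_ac (case_sum (($) P) (($) Q)) (s $ i)"
  by (simp add: value_at_def eval3_at_def base_change3_def eval_at_base_change)

lemma value_at_add: "value_at P Q (s + t) = value_at P Q s + value_at P Q t"
  by (simp add: vec_eq_iff value_at_nth)

lemma value_at_diff: "value_at P Q (s - t) = value_at P Q s - value_at P Q t"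
  by (simp add: vec_eq_iff value_at_nth)

lemma value_at_0: "value_at P Q 0 = 0"
  by (simp add: vec_eq_iff value_at_nth)

lemma value_at_scale3: "value_at P Q (scale3 c s) = to_ac c *s value_at P Q s"
  by (simp add: vec_eq_iff value_at_nth scale3_def)

lemma value_at_laws:
  "value_at P Q law0 = law0_at P Q" "value_at P Q (law1 a) = law1_at (to_ac a) P Q"
  "value_at P Q (law2 a) = law2_at (to_ac a) P Q"
  by (simp_all add: vec3_eq_iff value_at_nth law0_def law1_def law2_def)

lemma eval3_at_compose_linear:
  "eval3_at P Q (compose_linear L M s) = eval3_at (L *v P) (M *v Q) s"
proof -
  have "(\<lambda>x. eval_at P Q (case_sum (\<lambda>j. \<Sum>l\<in>UNIV. Const (L $ j $ l) * Var (Inl l))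
      (\<lambda>j. \<Sum>l\<in>UNIV. Const (M $ j $ l) * Var (Inr l)) x)) = case_sum (($) (L *v P)) (($) (M *v Q))"
    by (rule ext) (simp add: eval_at_def coefficient_id.subst_poly_sum matrix_vector_mult_def split: sum.split)
  then show ?thesis
    unfolding eval3_at_def compose_linear_def
    by (simp add: vec_eq_iff eval_at_subst_poly) (simp add: eval_at_def)
qed

lemma cong_EE_iff_eval3_at:
  "cong_EE a d s t \<longleftrightarrow>
     (\<forall>P\<in>curve (to_ac a) (to_ac d). \<forall>Q\<in>curve (to_ac a) (to_ac d). eval3_at P Q s = eval3_at P Q t)"
proof -
  have "eval_at P Q (s $ i - t $ i) = eval3_at P Q s $ i - eval3_at P Q t $ i" for P Q i
    unfolding eval3_at_def by (simp add: eval_at_def)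
  then show ?thesis unfolding cong_EE_def product_ideal_def by (auto simp: vec_eq_iff)
qed

lemma cong_EE_base_change_iff:
  "cong_EE a d (base_change3 s) (base_change3 t) \<longleftrightarrow>
     (\<forall>P\<in>curve (to_ac a) (to_ac d). \<forall>Q\<in>curve (to_ac a) (to_ac d). value_at P Q s = value_at P Q t)"
  by (simp add: cong_EE_iff_eval3_at value_at_def)

lemma cong_EE_0_iff:
  fixes s :: "'a::field bipoly ^ 3"
  shows "cong_EE a d (base_change3 s) 0 \<longleftrightarrow>
     (\<forall>P\<in>curve (to_ac a) (to_ac d). \<forall>Q\<in>curve (to_ac a) (to_ac d). value_at P Q s = 0)"
proof -
  have "base_change3 (0 :: 'a bipoly ^ 3) = 0"
    by (simp add: base_change3_def base_change_def vec_eq_iff poly_mapping_eq_iff Poly_Mapping.map.rep_eq fun_eq_iff)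
  then show ?thesis using cong_EE_base_change_iff[of a d s 0] by (simp add: value_at_0)
qed

section \<open>Bihomogeneous polynomials as coefficient matrices\<close>

lemma bihomogeneous_0: "bihomogeneous m n 0"
  by (simp add: bihomogeneous_def)

lemma bihomogeneous_add: "bihomogeneous m n p \<Longrightarrow> bihomogeneous m n q \<Longrightarrow> bihomogeneous m n (p + q)"
  using keys_add[of p q] by (auto simp: bihomogeneous_def)

lemma bihomogeneous_diff: "bihomogeneous m n p \<Longrightarrow> bihomogeneous m n q \<Longrightarrow> bihomogeneous m n (p - q)"
  for p :: "'a::comm_ring_1 bipoly"
  using keys_diff[of p q] by (auto simp: bihomogeneous_def)

lemma bihomogeneous_mult:
  assumes "bihomogeneous m n p" "bihomogeneous m' n' q"
  shows "bihomogeneous (m + m') (n + n') (p * q)"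
  unfolding bihomogeneous_def
proof
  fix e assume "e \<in> Poly_Mapping.keys (p * q)"
  then obtain u v where "u \<in> Poly_Mapping.keys p" "v \<in> Poly_Mapping.keys q" "e = u + v"
    using keys_mult[of p q] by blast
  then show "(\<Sum>i\<in>UNIV. Poly_Mapping.lookup e (Inl i)) = m + m' \<and>
      (\<Sum>i\<in>UNIV. Poly_Mapping.lookup e (Inr i)) = n + n'"
    using assms by (simp add: bihomogeneous_def lookup_add sum.distrib)
qed

lemma bihomogeneous_Const: "bihomogeneous 0 0 (Const c)"
  by (simp add: bihomogeneous_def Const_def)

lemma bihomogeneous_Var:
  "bihomogeneous 1 0 (Var (Inl i) :: 'a::zero_neq_one bipoly)"
  "bihomogeneous 0 1 (Var (Inr i) :: 'a::zero_neq_one bipoly)"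
  by (simp_all add: bihomogeneous_def Var_def lookup_single when_def)

lemma bidegree22_add: "s \<in> bidegree22 \<Longrightarrow> t \<in> bidegree22 \<Longrightarrow> s + t \<in> bidegree22"
  by (simp add: bidegree22_def bihomogeneous_add)

lemma bidegree22_scale3: "s \<in> bidegree22 \<Longrightarrow> scale3 c s \<in> bidegree22"
  using bihomogeneous_mult[OF bihomogeneous_Const] by (fastforce simp: bidegree22_def scale3_def)

lemma bidegree22_0: "0 \<in> bidegree22"
  by (simp add: bidegree22_def bihomogeneous_0)

lemma laws_bidegree22:
  fixes a :: "'a::field"
  shows "law0 \<in> (bidegree22 :: ('a bipoly ^ 3) set)" "law1 a \<in> bidegree22" "law2 a \<in> bidegree22"
proof -
  have M: "bihomogeneous 2 2 (Var (Inl i) * Var (Inl j) * Var (Inr k) * Var (Inr l) :: 'a bipoly)" for i j k l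
    using bihomogeneous_mult[OF bihomogeneous_mult[OF bihomogeneous_mult[OF
      bihomogeneous_Var(1) bihomogeneous_Var(1)] bihomogeneous_Var(2)] bihomogeneous_Var(2)]
    by (simp add: numeral_2_eq_2)
  have C: "bihomogeneous 2 2 (Const a * Var (Inl i) * Var (Inl j) * Var (Inr k) * Var (Inr l))" for i j k l
    using bihomogeneous_mult[OF bihomogeneous_Const M] by (simp add: mult.assoc numeral_2_eq_2)
  show "law0 \<in> (bidegree22 :: ('a bipoly ^ 3) set)" "law1 a \<in> bidegree22" "law2 a \<in> bidegree22"
    unfolding bidegree22_def mem_Collect_eq forall_3 law0_def law1_def law2_def vector_3
      power2_eq_square mult.assoc[symmetric]
    by (intro conjI bihomogeneous_diff M C)+
qed

text \<open>One ordered representative for each unordered pair of indices, that is, for each of the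
  six quadratic monomials in three variables.\<close>

definition index_pairs :: "(3 \<times> 3) set" where
  "index_pairs = {(1,1), (2,2), (3,3), (2,3), (1,3), (1,2)}"

lemma sum_index_pairs:
  "sum f index_pairs = f (1,1) + f (2,2) + f (3,3) + f (2,3) + f (1,3) + f (1,2)"
  by (simp add: index_pairs_def add.assoc)

lemma finite_index_pairs: "finite index_pairs"
  by (simp add: index_pairs_def)

definition pair_degree :: "3 \<times> 3 \<Rightarrow> 3 \<Rightarrow> nat" where
  "pair_degree r i = (if fst r = i then 1 else 0) + (if snd r = i then 1 else 0)"

lemma degree_2_index_pair:
  assumes "(\<Sum>i\<in>UNIV. f i) = (2::nat)"
  obtains r where "r \<in> index_pairs" "f = pair_degree r"
proof -
  have s: "f 1 + f 2 + f 3 = 2" using assms by (simp add: sum_3)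
  have R: "f = pair_degree r \<longleftrightarrow> f 1 = pair_degree r 1 \<and> f 2 = pair_degree r 2 \<and> f 3 = pair_degree r 3" for r
    by (simp add: fun_eq_iff forall_3)
  have three_nats: "(x = 2 \<and> y = 0 \<and> z = 0) \<or> (x = 0 \<and> y = 2 \<and> z = 0) \<or> (x = 0 \<and> y = 0 \<and> z = 2)
    \<or> (x = 0 \<and> y = 1 \<and> z = 1) \<or> (x = 1 \<and> y = 0 \<and> z = 1) \<or> (x = 1 \<and> y = 1 \<and> z = 0)"
    if "x + y + z = 2" for x y z :: nat
    using that by presburger
  consider "f 1 = 2 \<and> f 2 = 0 \<and> f 3 = 0" | "f 1 = 0 \<and> f 2 = 2 \<and> f 3 = 0"
    | "f 1 = 0 \<and> f 2 = 0 \<and> f 3 = 2" | "f 1 = 0 \<and> f 2 = 1 \<and> f 3 = 1"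
    | "f 1 = 1 \<and> f 2 = 0 \<and> f 3 = 1" | "f 1 = 1 \<and> f 2 = 1 \<and> f 3 = 0"
    using three_nats[OF s] by blast
  then show thesis
  proof cases
    case 1 then show ?thesis using that[of "(1,1)"] by (simp add: R pair_degree_def index_pairs_def)
  next
    case 2 then show ?thesis using that[of "(2,2)"] by (simp add: R pair_degree_def index_pairs_def)
  next
    case 3 then show ?thesis using that[of "(3,3)"] by (simp add: R pair_degree_def index_pairs_def)
  next
    case 4 then show ?thesis using that[of "(2,3)"] by (simp add: R pair_degree_def index_pairs_def)
  next
    case 5 then show ?thesis using that[of "(1,3)"] by (simp add: R pair_degree_def index_pairs_def)
  next
    case 6 then show ?thesis using that[of "(1,2)"] by (simp add: R pair_degree_def index_pairs_def)
  qed
qed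

lemma pair_degree_inj:
  assumes "r \<in> index_pairs" "s \<in> index_pairs" "pair_degree r = pair_degree s"
  shows "r = s"
proof -
  have "pair_degree r 1 = pair_degree s 1" "pair_degree r 2 = pair_degree s 2"
    "pair_degree r 3 = pair_degree s 3"
    using assms(3) by simp_all
  then show ?thesis using assms(1,2)
    by (auto simp: index_pairs_def pair_degree_def)
qed

definition exponent :: "3 \<times> 3 \<Rightarrow> 3 \<times> 3 \<Rightarrow> (3 + 3) \<Rightarrow>\<^sub>0 nat" where
  "exponent r s = Poly_Mapping.single (Inl (fst r)) 1 + Poly_Mapping.single (Inl (snd r)) 1 +
     (Poly_Mapping.single (Inr (fst s)) 1 + Poly_Mapping.single (Inr (snd s)) 1)"

lemma lookup_exponent:
  "Poly_Mapping.lookup (exponent r s) (Inl i) = pair_degree r i"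
  "Poly_Mapping.lookup (exponent r s) (Inr i) = pair_degree s i"
  by (simp_all add: exponent_def lookup_add lookup_single when_def pair_degree_def)

definition monomial2 :: "3 \<times> 3 \<Rightarrow> 'a::comm_ring_1 ^ 3 \<Rightarrow> 'a" where
  "monomial2 r P = P $ fst r * P $ snd r"

definition form22 :: "(3 \<times> 3 \<Rightarrow> 3 \<times> 3 \<Rightarrow> 'a::comm_ring_1) \<Rightarrow> 'a ^ 3 \<Rightarrow> 'a ^ 3 \<Rightarrow> 'a" where
  "form22 c P Q = (\<Sum>r\<in>index_pairs. \<Sum>s\<in>index_pairs. c r s * (monomial2 r P * monomial2 s Q))"

text \<open>The passage from finitely supported coefficient functions to 6 x 6 matrices:
  \<open>exponent\<close> is injective on pairs of quadratic monomials and reaches every key of a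
  polynomial of bidegree (2,2).\<close>

lemma (in coefficient_hom) subst_poly_bihomogeneous22:
  assumes "bihomogeneous 2 2 p"
  shows "subst_poly h (case_sum (($) P) (($) Q)) p
    = form22 (\<lambda>r s. h (Poly_Mapping.lookup p (exponent r s))) P Q"
proof -
  let ?v = "case_sum (($) P) (($) Q)"
  let ?e = "\<lambda>(r, s). exponent r s" and ?A = "index_pairs \<times> index_pairs"
  have inj: "inj_on ?e ?A"
  proof (rule inj_onI, clarify)
    fix r s r' s'
    assume i: "r \<in> index_pairs" "s \<in> index_pairs" "r' \<in> index_pairs" "s' \<in> index_pairs"
      and e: "exponent r s = exponent r' s'"
    have "pair_degree r = pair_degree r'" "pair_degree s = pair_degree s'"
      using lookup_exponent e by (metis ext)+
    then show "r = r' \<and> s = s'" using pair_degree_inj i by blast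
  qed
  have "m \<in> ?e ` ?A" if m: "m \<in> Poly_Mapping.keys p" for m
  proof -
    have d: "(\<Sum>i\<in>UNIV. Poly_Mapping.lookup m (Inl i)) = 2" "(\<Sum>i\<in>UNIV. Poly_Mapping.lookup m (Inr i)) = 2"
      using assms m by (simp_all add: bihomogeneous_def)
    obtain r where r: "r \<in> index_pairs" "(\<lambda>i. Poly_Mapping.lookup m (Inl i)) = pair_degree r"
      using degree_2_index_pair[OF d(1)] .
    obtain s where s: "s \<in> index_pairs" "(\<lambda>i. Poly_Mapping.lookup m (Inr i)) = pair_degree s"
      using degree_2_index_pair[OF d(2)] .
    have "m = exponent r s"
    proof (rule poly_mapping_eqI)
      fix k show "Poly_Mapping.lookup m k = Poly_Mapping.lookup (exponent r s) k"
        using fun_cong[OF r(2)] fun_cong[OF s(2)] by (cases k) (simp_all add: lookup_exponent)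
    qed
    then show ?thesis using r(1) s(1) by force
  qed
  then have "subst_poly h ?v p = (\<Sum>m\<in>?e ` ?A. h (Poly_Mapping.lookup p m) * monomial_at ?v m)"
    by (intro subst_poly_superset) (auto simp: finite_index_pairs)
  also have "\<dots> = (\<Sum>x\<in>?A. h (Poly_Mapping.lookup p (?e x)) * monomial_at ?v (?e x))"
    by (simp add: sum.reindex[OF inj])
  also have "\<dots> = (\<Sum>(r,s)\<in>?A. h (Poly_Mapping.lookup p (exponent r s)) * (monomial2 r P * monomial2 s Q))"
  proof (rule sum.cong)
    fix x assume "x \<in> ?A"
    have "monomial_at ?v (exponent r s) = monomial2 r P * monomial2 s Q" for r s
      unfolding exponent_def monomial_at_add monomial_at_single monomial2_def by simp
    then show "h (Poly_Mapping.lookup p (?e x)) * monomial_at ?v (?e x)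
      = (case x of (r, s) \<Rightarrow> h (Poly_Mapping.lookup p (exponent r s)) * (monomial2 r P * monomial2 s Q))"
      by (simp split: prod.split)
  qed simp
  finally show ?thesis by (simp add: form22_def sum.cartesian_product)
qed

section \<open>Forms vanishing on the curve\<close>

context smooth_hessian
begin

text \<open>Without a quadratic term the roots sum to zero, so the third is -r1 - r2. The assumed
  nonzero quantity is then -a^3 times the squared product of the root differences.\<close>

lemma cubic_three_roots:
  fixes p q :: 'a
  assumes "27 * a * q\<^sup>2 + 4 * p ^ 3 \<noteq> 0"
  obtains r1 r2 r3 where "r1 \<noteq> r2" "r1 \<noteq> r3" "r2 \<noteq> r3"
    "a * r1 ^ 3 + p * r1 + q = 0" "a * r2 ^ 3 + p * r2 + q = 0" "a * r3 ^ 3 + p * r3 + q = 0"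
proof -
  obtain r1 where "poly [:q, p, 0, a:] r1 = 0"
    using alg_closed_imp_poly_has_root[of "[:q, p, 0, a:]"] a0 by auto
  then have r1: "a * r1 ^ 3 + p * r1 + q = 0" by (simp add: power3_eq_cube algebra_simps)
  \<comment> \<open>The quotient of the cubic by x - r1.\<close>
  obtain r2 where "poly [:a * r1\<^sup>2 + p, a * r1, a:] r2 = 0"
    using alg_closed_imp_poly_has_root[of "[:a * r1\<^sup>2 + p, a * r1, a:]"] a0 by auto
  then have p: "p = - a * (r1\<^sup>2 + r1 * r2 + r2\<^sup>2)"
    by (simp add: power2_eq_square algebra_simps eq_neg_iff_add_eq_0)
  have q: "q = a * r1 * r2 * (r1 + r2)"
    using r1 unfolding p by (simp add: power2_eq_square power3_eq_cube algebra_simps eq_neg_iff_add_eq_0)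
  have d: "27 * a * q\<^sup>2 + 4 * p ^ 3 = - (a ^ 3) * ((r1 - r2) * (2 * r1 + r2) * (2 * r2 + r1))\<^sup>2 * 1"
    unfolding p q by (simp add: power2_eq_square power3_eq_cube algebra_simps)
  show thesis
  proof (rule that[of r1 r2 "- r1 - r2"])
    show "r1 \<noteq> r2" using assms d by auto
    show "r1 \<noteq> - r1 - r2"
    proof
      assume "r1 = - r1 - r2"
      then have "2 * r1 + r2 = 0" by (simp add: algebra_simps)
      then show False using assms d by simp
    qed
    show "r2 \<noteq> - r1 - r2"
    proof
      assume "r2 = - r1 - r2"
      then have "2 * r2 + r1 = 0" by (simp add: algebra_simps)
      then show False using assms d by simp
    qed
  qed (simp_all add: p q power2_eq_square power3_eq_cube algebra_simps)
qed

text \<open>In other words, 1, x, x^2 are independent over the polynomials in y on the affine curve.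
  For all but finitely many y there are three distinct x on the curve, too many roots for a
  quadratic in x; so each coefficient polynomial has infinitely many roots.\<close>

lemma affine_polynomials_zero:
  fixes A B C :: "'a poly"
  assumes "finite Y"
    and "\<And>x y. y \<notin> Y \<Longrightarrow> a * x ^ 3 + y ^ 3 + 1 = d * x * y \<Longrightarrow> poly A y + poly B y * x + poly C y * x\<^sup>2 = 0"
  shows "A = 0" "B = 0" "C = 0"
proof -
  \<comment> \<open>The discriminant, up to a unit, of the curve equation as a cubic in x; its value
    27a at y = 0 shows that it is not the zero polynomial.\<close>
  define D :: "'a poly" where "D = [:27 * a:] * [:1, 0, 0, 1:]\<^sup>2 - [:0, 0, 0, 4 * d ^ 3:]"
  have D: "poly D y = 27 * a * (y ^ 3 + 1)\<^sup>2 + 4 * (- d * y) ^ 3" for y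
    by (simp add: D_def power2_eq_square power3_eq_cube algebra_simps)
  have "(27 :: 'a) \<noteq> 0" using power_not_zero[OF three, of 3] by simp
  moreover have "poly D 0 = 27 * a" by (simp add: D)
  ultimately have "D \<noteq> 0" using a0 by (metis mult_eq_0_iff poly_0)
  define S where "S = - (Y \<union> {y. poly D y = 0})"
  have "finite (Y \<union> {y. poly D y = 0})" using assms(1) poly_roots_finite[OF \<open>D \<noteq> 0\<close>] by simp
  then have S: "infinite S" unfolding S_def
    using infinite_UNIV_alg_closed by (simp add: Compl_eq_Diff_UNIV)
  have zero: "poly A y = 0 \<and> poly B y = 0 \<and> poly C y = 0" if "y \<in> S" for y
  proof -
    have y: "y \<notin> Y" "27 * a * (y ^ 3 + 1)\<^sup>2 + 4 * (- d * y) ^ 3 \<noteq> 0"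
      using that D by (auto simp: S_def)
    obtain r1 r2 r3 where r: "r1 \<noteq> r2" "r1 \<noteq> r3" "r2 \<noteq> r3"
      "a * r1 ^ 3 + - d * y * r1 + (y ^ 3 + 1) = 0" "a * r2 ^ 3 + - d * y * r2 + (y ^ 3 + 1) = 0"
      "a * r3 ^ 3 + - d * y * r3 + (y ^ 3 + 1) = 0"
      using cubic_three_roots[OF y(2)] by metis
    let ?q = "[:poly A y, poly B y, poly C y:]"
    have root: "poly ?q x = 0" if "a * x ^ 3 + - d * y * x + (y ^ 3 + 1) = 0" for x
    proof -
      have "a * x ^ 3 + y ^ 3 + 1 = d * x * y" using that by (simp add: algebra_simps)
      from assms(2)[OF y(1) this] show ?thesis by (simp add: power2_eq_square algebra_simps)
    qed
    have "?q = 0"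
    proof (rule ccontr)
      assume nz: "?q \<noteq> 0"
      have "{r1, r2, r3} \<subseteq> {x. poly ?q x = 0}" using root r by blast
      then have "card {r1, r2, r3} \<le> card {x. poly ?q x = 0}"
        by (rule card_mono[OF poly_roots_finite[OF nz]])
      also have "\<dots> \<le> Polynomial.degree ?q" by (rule card_poly_roots_bound[OF nz])
      also have "\<dots> \<le> 2" by simp
      finally show False using r(1-3) by simp
    qed
    then show ?thesis by simp
  qed
  have vanish: "p = 0" if "\<And>y. y \<in> S \<Longrightarrow> poly p y = 0" for p :: "'a poly"
  proof (rule ccontr)
    assume "p \<noteq> 0"
    moreover have "S \<subseteq> {y. poly p y = 0}" using that by auto
    ultimately show False using S poly_roots_finite finite_subset by blast
  qed
  show "A = 0" "B = 0" "C = 0" using vanish zero by blast+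
qed

definition affine :: "'a \<Rightarrow> 'a \<Rightarrow> 'a ^ 3" where
  "affine x y = vector [x, y, 1]"

lemma affine_nth [simp]: "affine x y $ 1 = x" "affine x y $ 2 = y" "affine x y $ 3 = 1"
  by (simp_all add: affine_def)

lemma affine_curve: "affine x y \<in> E \<longleftrightarrow> a * x ^ 3 + y ^ 3 + 1 = d * x * y"
  by (auto simp: curve_def hessian_form_def vec3_eq_iff)

text \<open>On Z = 1 a quadratic form already has degree at most 2 in x, so no reduction by the
  curve equation is needed. A finite exceptional set excludes only finitely many y.\<close>

lemma quadratic_form_zero:
  assumes "finite Bad"
    and "\<And>Q. Q \<in> E \<Longrightarrow> Q$3 = 1 \<Longrightarrow> Q \<notin> Bad \<Longrightarrow> (\<Sum>r\<in>index_pairs. c r * monomial2 r Q) = 0"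
  shows "(\<Sum>r\<in>index_pairs. c r * monomial2 r Q) = 0" "r \<in> index_pairs \<Longrightarrow> c r = 0"
proof -
  have "poly [:c (3,3), c (2,3), c (2,2):] y + poly [:c (1,3), c (1,2):] y * x + poly [:c (1,1):] y * x\<^sup>2 = 0"
    if "y \<notin> (\<lambda>Q. Q$2) ` Bad" "a * x ^ 3 + y ^ 3 + 1 = d * x * y" for x y
  proof -
    have "affine x y \<notin> Bad" using that(1) by force
    then have "(\<Sum>r\<in>index_pairs. c r * monomial2 r (affine x y)) = 0"
      using assms(2)[of "affine x y"] that(2) by (simp add: affine_curve)
    then show ?thesis
      by (simp add: sum_index_pairs monomial2_def power2_eq_square algebra_simps)
  qed
  note affine_polynomials_zero[OF finite_imageI[OF assms(1)] this]
  then have z: "c (3,3) = 0" "c (2,3) = 0" "c (2,2) = 0" "c (1,3) = 0" "c (1,2) = 0" "c (1,1) = 0"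
    by simp_all
  then show "(\<Sum>r\<in>index_pairs. c r * monomial2 r Q) = 0" by (simp add: sum_index_pairs)
  show "r \<in> index_pairs \<Longrightarrow> c r = 0" using z by (auto simp: index_pairs_def)
qed

text \<open>
  In the next three lemmas a quartic form vanishing on the curve is reduced to degree at most 2 in
  \<open>X\<close> by the curve equation, on the chart \<open>Z = 1\<close> and after multiplication by \<open>a\<close>.
\<close>
lemma quartic_XX_YZ:
  assumes "\<And>P. P \<in> E \<Longrightarrow> (\<Sum>r\<in>index_pairs. u r * monomial2 r P) * (P$1)\<^sup>2
      + (\<Sum>r\<in>index_pairs. v r * monomial2 r P) * (P$2 * P$3) = 0"
  shows "\<forall>r\<in>index_pairs. u r = (if r = (2,3) then u (2,3) else 0)"
    "\<forall>r\<in>index_pairs. v r = (if r = (1,1) then - u (2,3) else 0)"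
proof -
  let ?A = "[:0, a * v (3,3), a * v (2,3), a * v (2,2):] - [:u (1,3), u (1,2):] * [:1, 0, 0, 1:]"
  let ?B = "[:0, a * v (1,3), a * v (1,2):] + [:0, d * u (1,3), d * u (1,2):] - [:u (1,1):] * [:1, 0, 0, 1:]"
  let ?C = "[:a * u (3,3), a * u (2,3) + a * v (1,1) + d * u (1,1), a * u (2,2):]"
  have "poly ?A y + poly ?B y * x + poly ?C y * x\<^sup>2 = 0" if e: "a * x ^ 3 + y ^ 3 + 1 = d * x * y" for x y
  proof -
    have "a * x ^ 3 = d * x * y - y ^ 3 - 1" using e by (simp add: algebra_simps)
    have "0 = a * ((\<Sum>r\<in>index_pairs. u r * monomial2 r (affine x y)) * x\<^sup>2
      + (\<Sum>r\<in>index_pairs. v r * monomial2 r (affine x y)) * y)"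
      using assms[of "affine x y"] e by (simp add: affine_curve)
    also have "\<dots> = poly ?A y + poly ?B y * x + poly ?C y * x\<^sup>2
        + (u (1,1) * x + u (1,2) * y + u (1,3)) * (a * x ^ 3 + y ^ 3 + 1 - d * x * y)"
      by (simp add: sum_index_pairs monomial2_def power2_eq_square power3_eq_cube algebra_simps)
    finally show ?thesis using e by simp
  qed
  note affine_polynomials_zero[OF finite.emptyI this]
  then have A: "?A = 0" and B: "?B = 0" and C: "?C = 0" by blast+
  from B have "u (1,1) = 0" by simp
  moreover from A have "u (1,3) = 0" "u (1,2) = 0" by simp_all
  moreover from C a0 have "u (3,3) = 0" "u (2,2) = 0" by simp_all
  ultimately have z: "u (1,1) = 0" "u (1,3) = 0" "u (1,2) = 0" "u (3,3) = 0" "u (2,2) = 0"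
    "v (3,3) = 0" "v (2,3) = 0" "v (2,2) = 0" "v (1,3) = 0" "v (1,2) = 0"
    "a * u (2,3) + a * v (1,1) = 0"
    using A B C a0 by simp_all
  \<comment> \<open>Only the tautological relation YZ * X^2 - X^2 * YZ = 0 survives, with one free
    coefficient.\<close>
  then have "v (1,1) = - u (2,3)"
    using a0 by (simp add: eq_neg_iff_add_eq_0 add.commute flip: distrib_left)
  then show "\<forall>r\<in>index_pairs. u r = (if r = (2,3) then u (2,3) else 0)"
    "\<forall>r\<in>index_pairs. v r = (if r = (1,1) then - u (2,3) else 0)"
    using z by (simp_all add: index_pairs_def)
qed

lemma quartic_ZZ_XY:
  assumes "\<And>P. P \<in> E \<Longrightarrow> (\<Sum>r\<in>index_pairs. u r * monomial2 r P) * (P$3)\<^sup>2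
      + (\<Sum>r\<in>index_pairs. v r * monomial2 r P) * (P$1 * P$2) = 0"
  shows "\<forall>r\<in>index_pairs. u r = (if r = (1,2) then u (1,2) else 0)"
    "\<forall>r\<in>index_pairs. v r = (if r = (3,3) then - u (1,2) else 0)"
proof -
  let ?A = "[:a * u (3,3), a * u (2,3) - v (1,1), a * u (2,2), 0, - v (1,1):]"
  let ?B = "[:a * u (1,3), a * u (1,2) + a * v (3,3), a * v (2,3) + d * v (1,1), a * v (2,2):]"
  let ?C = "[:a * u (1,1), a * v (1,3), a * v (1,2):]"
  have "poly ?A y + poly ?B y * x + poly ?C y * x\<^sup>2 = 0" if e: "a * x ^ 3 + y ^ 3 + 1 = d * x * y" for x y
  proof -
    have "0 = a * ((\<Sum>r\<in>index_pairs. u r * monomial2 r (affine x y))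
      + (\<Sum>r\<in>index_pairs. v r * monomial2 r (affine x y)) * (x * y))"
      using assms[of "affine x y"] e by (simp add: affine_curve)
    also have "\<dots> = poly ?A y + poly ?B y * x + poly ?C y * x\<^sup>2
        + v (1,1) * y * (a * x ^ 3 + y ^ 3 + 1 - d * x * y)"
      by (simp add: sum_index_pairs monomial2_def power2_eq_square power3_eq_cube algebra_simps)
    finally show ?thesis using e by simp
  qed
  note affine_polynomials_zero[OF finite.emptyI this]
  then have A: "?A = 0" and B: "?B = 0" and C: "?C = 0" by blast+
  from A have "v (1,1) = 0" by simp
  then have z: "u (1,1) = 0" "u (1,3) = 0" "u (2,3) = 0" "u (3,3) = 0" "u (2,2) = 0"
    "v (1,1) = 0" "v (2,3) = 0" "v (2,2) = 0" "v (1,3) = 0" "v (1,2) = 0"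
    "a * u (1,2) + a * v (3,3) = 0"
    using A B C a0 by simp_all
  then have "v (3,3) = - u (1,2)"
    using a0 by (simp add: eq_neg_iff_add_eq_0 add.commute flip: distrib_left)
  then show "\<forall>r\<in>index_pairs. u r = (if r = (1,2) then u (1,2) else 0)"
    "\<forall>r\<in>index_pairs. v r = (if r = (3,3) then - u (1,2) else 0)"
    using z by (simp_all add: index_pairs_def)
qed

lemma quartic_YY_XZ:
  assumes "\<And>P. P \<in> E \<Longrightarrow> (\<Sum>r\<in>index_pairs. u r * monomial2 r P) * (P$2)\<^sup>2
      + (\<Sum>r\<in>index_pairs. v r * monomial2 r P) * (P$1 * P$3) = 0"
  shows "\<forall>r\<in>index_pairs. u r = (if r = (1,3) then u (1,3) else 0)"
    "\<forall>r\<in>index_pairs. v r = (if r = (2,2) then - u (1,3) else 0)"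
proof -
  let ?A = "[:- v (1,1), 0, a * u (3,3), a * u (2,3) - v (1,1), a * u (2,2):]"
  let ?B = "[:a * v (3,3), a * v (2,3) + d * v (1,1), a * u (1,3) + a * v (2,2), a * u (1,2):]"
  let ?C = "[:a * v (1,3), a * v (1,2), a * u (1,1):]"
  have "poly ?A y + poly ?B y * x + poly ?C y * x\<^sup>2 = 0" if e: "a * x ^ 3 + y ^ 3 + 1 = d * x * y" for x y
  proof -
    have "0 = a * ((\<Sum>r\<in>index_pairs. u r * monomial2 r (affine x y)) * y\<^sup>2
      + (\<Sum>r\<in>index_pairs. v r * monomial2 r (affine x y)) * x)"
      using assms[of "affine x y"] e by (simp add: affine_curve)
    also have "\<dots> = poly ?A y + poly ?B y * x + poly ?C y * x\<^sup>2
        + v (1,1) * (a * x ^ 3 + y ^ 3 + 1 - d * x * y)"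
      by (simp add: sum_index_pairs monomial2_def power2_eq_square power3_eq_cube algebra_simps)
    finally show ?thesis using e by simp
  qed
  note affine_polynomials_zero[OF finite.emptyI this]
  then have A: "?A = 0" and B: "?B = 0" and C: "?C = 0" by blast+
  from A have "v (1,1) = 0" by simp
  then have z: "u (1,1) = 0" "u (1,2) = 0" "u (2,3) = 0" "u (3,3) = 0" "u (2,2) = 0"
    "v (1,1) = 0" "v (2,3) = 0" "v (3,3) = 0" "v (1,3) = 0" "v (1,2) = 0"
    "a * u (1,3) + a * v (2,2) = 0"
    using A B C a0 by simp_all
  then have "v (2,2) = - u (1,3)"
    using a0 by (simp add: eq_neg_iff_add_eq_0 add.commute flip: distrib_left)
  then show "\<forall>r\<in>index_pairs. u r = (if r = (1,3) then u (1,3) else 0)"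
    "\<forall>r\<in>index_pairs. v r = (if r = (2,2) then - u (1,3) else 0)"
    using z by (simp_all add: index_pairs_def)
qed

text \<open>
  For a primitive cube root of unity \<open>w\<close>, the points \<open>Q = (X, w\<^sup>i Z, w\<^sup>2\<^sup>i Y)\<close> are the ones with
  \<open>X(P + Q) = 0\<close>; summing over \<open>i\<close> against characters isolates the three weight components of
  the form.
\<close>
lemma form22_vanishing_determined:
  assumes c: "\<And>P Q. P \<in> E \<Longrightarrow> Q \<in> E \<Longrightarrow> \<forall>S\<in>laws_at a P Q. S $ 1 = 0 \<Longrightarrow> form22 c P Q = 0"
  shows "form22 c P Q = - c (2,3) (1,1) * law0_at P Q $ 1
    + c (1,2) (2,2) * law1_at a P Q $ 1 + c (1,3) (3,3) * law2_at a P Q $ 1"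
proof -
  obtain w :: 'a where "poly [:1, 1, 1:] w = 0"
    using alg_closed_imp_poly_has_root[of "[:1, 1, 1:] :: 'a poly"] by auto
  then have w2: "w\<^sup>2 = - 1 - w" by (simp add: power2_eq_square algebra_simps eq_neg_iff_add_eq_0)
  then have ww: "w * w = - 1 - w" by (simp add: power2_eq_square)
  have w3: "w ^ 3 = 1" by (simp add: power3_eq_cube ww left_diff_distrib)
  define q where "q s P = (\<Sum>r\<in>index_pairs. c r s * monomial2 r P)" for s P
  have form: "form22 c P Q = (\<Sum>s\<in>index_pairs. q s P * monomial2 s Q)" for P Q
    unfolding form22_def q_def by (subst sum.swap) (simp add: sum_distrib_right mult.assoc)
  \<comment> \<open>At Q = (X, eZ, e^2 Y) with e^3 = 1 the monomials in \<open>Q\<close> acquire a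
    power of e: \<open>al\<close>, \<open>be\<close> and \<open>ga\<close> collect exponents 0, 2
    and 1 modulo 3.\<close>
  define al where "al P = q (1,1) P * (P$1)\<^sup>2 + q (2,3) P * (P$2 * P$3)" for P
  define be where "be P = q (2,2) P * (P$3)\<^sup>2 + q (1,3) P * (P$1 * P$2)" for P
  define ga where "ga P = q (3,3) P * (P$2)\<^sup>2 + q (1,2) P * (P$1 * P$3)" for P
  have twist: "al P + e\<^sup>2 * be P + e * ga P = 0" if P: "P \<in> E" and e: "e ^ 3 = 1" for P e
  proof -
    define Q :: "'a ^ 3" where "Q = vector [P$1, e * P$3, e\<^sup>2 * P$2]"
    have Q: "Q$1 = P$1" "Q$2 = e * P$3" "Q$3 = e\<^sup>2 * P$2" by (simp_all add: Q_def)
    have "(e\<^sup>2) ^ 3 = (e ^ 3)\<^sup>2" by (simp flip: power_mult)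
    then have e6: "(e\<^sup>2) ^ 3 = 1" using e by simp
    have "Q \<noteq> 0"
      using curve_not_0[OF P] e by (auto simp: vec3_eq_iff Q)
    moreover have "hessian_form a d Q = hessian_form a d P"
    proof -
      have "hessian_form a d Q = a * P$1 ^ 3 + e ^ 3 * P$3 ^ 3 + (e\<^sup>2) ^ 3 * P$2 ^ 3 - d * P$1 * P$2 * P$3 * e ^ 3"
        unfolding hessian_form_def Q by (simp add: power_mult_distrib power2_eq_square power3_eq_cube mult_ac)
      then show ?thesis unfolding e e6 by (simp add: hessian_form_def)
    qed
    ultimately have "Q \<in> E" using P by (simp add: curve_def)
    moreover have "\<forall>S\<in>laws_at a P Q. S $ 1 = 0"
    proof -
      have "law0_at P Q $ 1 = (P$1)\<^sup>2 * P$2 * P$3 * (e ^ 3 - 1)"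
        "law1_at a P Q $ 1 = 0" "law2_at a P Q $ 1 = P$1 * P$3 * (P$2)\<^sup>2 * e * (e ^ 3 - 1)"
        by (simp_all add: Q power2_eq_square power3_eq_cube algebra_simps)
      then show ?thesis unfolding laws_at_def e by simp
    qed
    ultimately have "form22 c P Q = 0" using c P by blast
    moreover have "form22 c P Q = al P + e\<^sup>2 * be P + e * ga P
        + (e ^ 3 - 1) * (q (2,3) P * P$2 * P$3 + e * q (3,3) P * (P$2)\<^sup>2)"
      unfolding form al_def be_def ga_def
      by (simp add: sum_index_pairs monomial2_def Q power2_eq_square power3_eq_cube algebra_simps)
    ultimately show ?thesis unfolding e by simp
  qed
  have abc: "al P = 0 \<and> be P = 0 \<and> ga P = 0" if P: "P \<in> E" for P
  proof -
    have t1: "al P + be P + ga P = 0" using twist[OF P, of 1] by simp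
    have t2: "al P + w\<^sup>2 * be P + w * ga P = 0" using twist[OF P w3] .
    have w4: "(w\<^sup>2)\<^sup>2 = w" using w3 by (simp add: power2_eq_square power3_eq_cube mult.assoc)
    have w6: "(w\<^sup>2) ^ 3 = 1"
      using w3 w4 by (simp add: power3_eq_cube power2_eq_square mult.assoc)
    have t3: "al P + w * be P + w\<^sup>2 * ga P = 0" using twist[OF P w6] unfolding w4 .
    \<comment> \<open>Summing over e = 1, w, w^2 cancels the nontrivial characters.\<close>
    have "3 * al P = (al P + be P + ga P) + (al P + w\<^sup>2 * be P + w * ga P) + (al P + w * be P + w\<^sup>2 * ga P)"
      unfolding w2 by (simp add: algebra_simps)
    then have "3 * al P = 0" unfolding t1 t2 t3 by simp
    then have al: "al P = 0" using three by simp
    have be: "be P = - ga P" using t1 al by (simp add: eq_neg_iff_add_eq_0)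
    have "(1 + 2 * w) * ga P = 0" using t2 unfolding al be w2 by (simp add: algebra_simps)
    \<comment> \<open>1 + 2w is w - w^2, a square root of -3, hence nonzero.\<close>
    moreover have "(1 + 2 * w)\<^sup>2 = 1 + 4 * w + 4 * w\<^sup>2" by (simp add: power2_eq_square algebra_simps)
    then have "(1 + 2 * w)\<^sup>2 = - 3" unfolding w2 by simp
    then have "1 + 2 * w \<noteq> 0" using three by auto
    ultimately show ?thesis using al be by simp
  qed
  have "(\<Sum>r\<in>index_pairs. c r (1,1) * monomial2 r P) * (P$1)\<^sup>2
      + (\<Sum>r\<in>index_pairs. c r (2,3) * monomial2 r P) * (P$2 * P$3) = 0"
    "(\<Sum>r\<in>index_pairs. c r (2,2) * monomial2 r P) * (P$3)\<^sup>2
      + (\<Sum>r\<in>index_pairs. c r (1,3) * monomial2 r P) * (P$1 * P$2) = 0"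
    "(\<Sum>r\<in>index_pairs. c r (3,3) * monomial2 r P) * (P$2)\<^sup>2
      + (\<Sum>r\<in>index_pairs. c r (1,2) * monomial2 r P) * (P$1 * P$3) = 0" if "P \<in> E" for P
    using abc[OF that] unfolding al_def be_def ga_def q_def by blast+
  \<comment> \<open>Each weight component leaves one free coefficient, so of the 36 entries of
    \<open>c\<close> three remain free, one for each law; they are the ones appearing in the
    conclusion.\<close>
  note z = quartic_XX_YZ[OF this(1)] quartic_ZZ_XY[OF this(2)] quartic_YY_XZ[OF this(3)]
  note z = z[unfolded index_pairs_def, simplified]
  have "form22 c P Q = c (2,3) (1,1) * (P$2 * P$3 * (Q$1 * Q$1)) - c (2,3) (1,1) * (P$1 * P$1 * (Q$2 * Q$3))
      + (c (1,2) (2,2) * (P$1 * P$2 * (Q$2 * Q$2)) - c (1,2) (2,2) * (P$3 * P$3 * (Q$1 * Q$3)))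
      + (c (1,3) (3,3) * (P$1 * P$3 * (Q$3 * Q$3)) - c (1,3) (3,3) * (P$2 * P$2 * (Q$1 * Q$2)))"
    by (simp add: form22_def sum_index_pairs monomial2_def z)
  then show ?thesis by (simp add: power2_eq_square algebra_simps)
qed

end

section \<open>The space of addition laws and its eigenvectors\<close>

context smooth_hessian
begin

text \<open>A point with X = 0 normalises to (0, 1, r) with r^3 = -1, and \<open>P\<close> together
  with the sum determines the other summand. Fixing Z = 1 removes the rescalings of
  \<open>Q\<close>, which would otherwise make the set infinite.\<close>

lemma finite_sum_on_X0:
  assumes "P \<in> E"
  shows "finite {Q. Q$3 = 1 \<and> (\<exists>S. S$1 = 0 \<and> is_sum a d P Q S)}" (is "finite ?Bad")
proof -
  define T where "T r = (vector [0, 1, r] :: 'a ^ 3)" for r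
  have T: "T r $ 1 = 0" "T r $ 2 = 1" "T r $ 3 = r" for r by (simp_all add: T_def)
  have "finite {r :: 'a. poly [:1, 0, 0, 1:] r = 0}" by (rule poly_roots_finite) simp
  moreover have "finite {Q. Q$3 = 1 \<and> is_sum a d P Q (T r)}" (is "finite ?A") for r
  proof (cases "?A = {}")
    case False
    then obtain Q0 where Q0: "Q0 \<in> ?A" by blast
    have "Q = Q0" if "Q \<in> ?A" for Q
      using is_sum_unique_summand[of P Q0 "T r" Q] Q0 that by (auto simp: vec3_eq_iff)
    then have "?A \<subseteq> {Q0}" by blast
    then show ?thesis using finite_subset by blast
  qed (metis finite.emptyI)
  ultimately have "finite (\<Union>r\<in>{r. poly [:1, 0, 0, 1:] r = 0}. {Q. Q$3 = 1 \<and> is_sum a d P Q (T r)})"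
    by (intro finite_UN_I)
  moreover have "?Bad \<subseteq> (\<Union>r\<in>{r. poly [:1, 0, 0, 1:] r = 0}. {Q. Q$3 = 1 \<and> is_sum a d P Q (T r)})"
  proof
    fix Q assume "Q \<in> ?Bad"
    then obtain S where Q: "Q$3 = 1" and S: "S$1 = 0" "is_sum a d P Q S" by blast
    have SE: "S \<in> E" using S(2) line_section_curve3 unfolding is_sum_iff by force
    then have e: "S$2 ^ 3 + S$3 ^ 3 = 0" using curveD[OF SE] S(1) by simp
    then have nz: "S$2 \<noteq> 0" using curve_not_0[OF SE] S(1) by auto
    define r where "r = S$3 / S$2"
    have "S$2 ^ 3 * (1 + r ^ 3) = 0"
      using e nz by (simp add: r_def power_divide distrib_left)
    then have "poly [:1, 0, 0, 1:] r = 0" using nz by (simp add: power3_eq_cube mult.assoc)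
    moreover have "T r = (1 / S$2) *s S" using S(1) nz by (simp add: vec3_eq_iff T r_def)
    then have "is_sum a d P Q (T r)" using is_sum_scale[OF S(2), of "1 / S$2"] nz by simp
    ultimately show "Q \<in> (\<Union>r\<in>{r. poly [:1, 0, 0, 1:] r = 0}. {Q. Q$3 = 1 \<and> is_sum a d P Q (T r)})"
      using Q by blast
  qed
  ultimately show ?thesis using finite_subset by blast
qed

lemma bidegree22_vanishes_if_X0:
  assumes F: "\<And>P Q i. F P Q $ i = form22 (c i) P Q"
    and sum: "\<And>P Q. P \<in> E \<Longrightarrow> Q \<in> E \<Longrightarrow> F P Q = 0 \<or> is_sum a d P Q (F P Q)"
    and X0: "\<And>P Q. P \<in> E \<Longrightarrow> Q \<in> E \<Longrightarrow> F P Q $ 1 = 0"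
    and PQ: "P \<in> E" "Q \<in> E"
  shows "F P Q = 0"
proof -
  have "F P Q $ i = 0" for i
  proof -
    have form: "F P Q $ i = (\<Sum>s\<in>index_pairs. (\<Sum>r\<in>index_pairs. c i r s * monomial2 r P) * monomial2 s Q)" for Q
      unfolding F form22_def by (subst sum.swap) (simp add: sum_distrib_right mult.assoc)
    have "F P Q $ i = 0"
      if "Q \<in> E" "Q$3 = 1" "Q \<notin> {Q. Q$3 = 1 \<and> (\<exists>S. S$1 = 0 \<and> is_sum a d P Q S)}" for Q
      using that sum[OF PQ(1) that(1)] X0[OF PQ(1) that(1)] by auto
    then show ?thesis
      unfolding form by (rule quadratic_form_zero(1)[OF finite_sum_on_X0[OF PQ(1)]])
  qed
  then show ?thesis by (simp add: vec_eq_iff)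
qed

section \<open>Linear combinations of values of addition laws\<close>

lemma zero_or_sum_scale:
  assumes "V = 0 \<or> is_sum a d P Q V" shows "k *s V = 0 \<or> is_sum a d P Q (k *s V)"
  using assms is_sum_scale by (cases "k = 0") auto

text \<open>Nonzero vectors representing the same sum are proportional; this is what makes addition
  laws together with zero a vector space.\<close>

lemma zero_or_sum_add:
  assumes "V = 0 \<or> is_sum a d P Q V" "W = 0 \<or> is_sum a d P Q W"
  shows "V + W = 0 \<or> is_sum a d P Q (V + W)"
proof (cases "V = 0 \<or> W = 0")
  case False
  then obtain k where "W = k *s V" using assms is_sum_unique by metis
  then have "V + W = (1 + k) *s V" by (simp add: vec3_eq_iff algebra_simps)
  then show ?thesis using zero_or_sum_scale assms(1) by metis
qed (use assms in auto)

lemma laws_zero_or_sum: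
  "P \<in> E \<Longrightarrow> Q \<in> E \<Longrightarrow> S \<in> laws_at a P Q \<Longrightarrow> S = 0 \<or> is_sum a d P Q S"
  using is_sum_laws by blast

text \<open>Up to a scalar, \<open>translate e\<close> is translation by the point \<open>(0 : 1 : e)\<close>, where \<open>e\<^sup>3 = -1\<close>.\<close>
definition translate :: "'a \<Rightarrow> 'a ^ 3 \<Rightarrow> 'a ^ 3" where
  "translate e P = vector [P$1, - e * P$2, e\<^sup>2 * P$3]"

lemma translate_nth [simp]:
  "translate e P $ 1 = P$1" "translate e P $ 2 = - e * P$2" "translate e P $ 3 = e\<^sup>2 * P$3"
  by (simp_all add: translate_def)

lemma X0_slope:
  assumes "R \<in> E" "R$1 = 0"
  shows "R$2 \<noteq> 0" "R$3 = R$3 / R$2 * R$2" "(R$3 / R$2) ^ 3 = - 1"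
proof -
  have e: "R$2 ^ 3 + R$3 ^ 3 = 0" using curveD[OF assms(1)] assms(2) by simp
  then show nz: "R$2 \<noteq> 0" using curve_not_0[OF assms(1)] assms(2) by auto
  then show "R$3 = R$3 / R$2 * R$2" by simp
  have "R$3 ^ 3 = - (R$2 ^ 3)" using e by (simp add: eq_neg_iff_add_eq_0 add.commute)
  then show "(R$3 / R$2) ^ 3 = - 1" using nz by (simp add: power_divide)
qed

text \<open>With second argument (0, s, es), each law factors as a multiple of one coordinate of
  \<open>P\<close> times \<open>translate e P\<close>, so whichever law is nonzero gives the same
  point.\<close>

lemma is_sum_translate:
  assumes "P \<in> E" "R \<in> E" "R$1 = 0"
  shows "is_sum a d P R (translate (R$3 / R$2) P)"
proof -
  define e where "e = R$3 / R$2"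
  define s where "s = R$2"
  have R: "R$1 = 0" "R$2 = s" "R$3 = e * s" and s: "s \<noteq> 0" and e3: "e ^ 3 = - 1"
    using X0_slope[OF assms(2,3)] assms(3) by (simp_all add: e_def s_def)
  have e: "e * (e * e) = - 1" "e * (e * (e * x)) = - x" for x
    using e3 by (simp_all add: power3_eq_cube flip: mult.assoc)
  have "law0_at P R = (P$1 * s\<^sup>2 * e) *s translate e P" "law1_at a P R = (P$2 * s\<^sup>2) *s translate e P"
    "law2_at a P R = (P$3 * s\<^sup>2 * e\<^sup>2) *s translate e P"
    by (simp_all add: vec3_eq_iff R power2_eq_square algebra_simps e)
  then have "\<exists>k. S = k *s translate e P" if "S \<in> laws_at a P R" for S
    using that unfolding laws_at_def by blast
  moreover obtain S where S: "S \<in> laws_at a P R" "S \<noteq> 0" using laws_at_not_all_0[OF assms(1,2)] .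
  ultimately obtain k where k: "S = k *s translate e P" by blast
  then have k0: "k \<noteq> 0" using S(2) by auto
  then have "(1 / k) *s S = translate e P" using k by (simp add: vec3_eq_iff)
  then show ?thesis
    using is_sum_scale[OF is_sum_laws[OF assms(1,2) S], of "1 / k"] k0 by (simp add: e_def)
qed

lemma quadratic_zero:
  assumes "\<And>P. P \<in> E \<Longrightarrow> c11 * (P$1)\<^sup>2 + c22 * (P$2)\<^sup>2 + c33 * (P$3)\<^sup>2
     + c23 * (P$2 * P$3) + c13 * (P$1 * P$3) + c12 * (P$1 * P$2) = 0"
  shows "c11 = 0" "c22 = 0" "c33 = 0" "c23 = 0" "c13 = 0" "c12 = 0"
proof -
  define c where "c r = (if r = (1,1) then c11 else if r = (2,2) then c22 else if r = (3,3) then c33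
    else if r = (2,3) then c23 else if r = (1,3) then c13 else c12)" for r :: "3 \<times> 3"
  have "(\<Sum>r\<in>index_pairs. c r * monomial2 r P) = 0" if "P \<in> E" for P
    using assms[OF that] by (simp add: sum_index_pairs monomial2_def c_def power2_eq_square)
  then have "c r = 0" if "r \<in> index_pairs" for r
    using quadratic_form_zero(2)[OF finite.emptyI _ that, of c] by blast
  then have "\<forall>r\<in>index_pairs. c r = 0" by blast
  then show "c11 = 0" "c22 = 0" "c33 = 0" "c23 = 0" "c13 = 0" "c12 = 0"
    by (simp_all add: index_pairs_def c_def)
qed

text \<open>Eigenvectors must be tested on every matrix inducing the translation. The 2 x 2 minors
  of \<open>L *v P\<close> against \<open>translate e P\<close> are quadratic forms in
  \<open>P\<close> vanishing on E, so their coefficients vanish; this determines \<open>L\<close> up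
  to a scalar.\<close>

lemma translation_matrix_unique:
  assumes R: "R \<in> E" "R$1 = 0" and L: "\<And>P. P \<in> E \<Longrightarrow> is_sum a d P R (L *v P)"
  obtains k where "k \<noteq> 0" "\<And>P. L *v P = k *s translate (R$3 / R$2) P"
proof -
  define e where "e = R$3 / R$2"
  have e3: "e ^ 3 = - 1" using X0_slope[OF R] by (simp add: e_def)
  then have e0: "e \<noteq> 0" by auto
  have Lv: "(L *v P) $ i = L$i$1 * P$1 + L$i$2 * P$2 + L$i$3 * P$3" for P i
    by (simp add: matrix_vector_mult_def sum_3)
  have LP: "\<exists>k. L *v P = k *s translate e P" if "P \<in> E" for P
    using is_sum_unique[OF is_sum_translate[OF that R] L[OF that]] unfolding e_def by metis
  have "(- L$2$1) * (P$1)\<^sup>2 + (- e * L$1$2) * (P$2)\<^sup>2 + 0 * (P$3)\<^sup>2 + (- e * L$1$3) * (P$2 * P$3)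
      + (- L$2$3) * (P$1 * P$3) + (- e * L$1$1 - L$2$2) * (P$1 * P$2) = 0" if "P \<in> E" for P
  proof -
    obtain k where "L *v P = k *s translate e P" using LP[OF \<open>P \<in> E\<close>] by blast
    then have "(L *v P) $ 1 * translate e P $ 2 - (L *v P) $ 2 * translate e P $ 1 = 0" by simp
    then show ?thesis unfolding Lv by (simp add: power2_eq_square algebra_simps)
  qed
  note m12 = quadratic_zero[OF this]
  have "(- L$3$1) * (P$1)\<^sup>2 + 0 * (P$2)\<^sup>2 + (e\<^sup>2 * L$1$3) * (P$3)\<^sup>2 + (e\<^sup>2 * L$1$2) * (P$2 * P$3)
      + (e\<^sup>2 * L$1$1 - L$3$3) * (P$1 * P$3) + (- L$3$2) * (P$1 * P$2) = 0" if "P \<in> E" for P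
  proof -
    obtain k where "L *v P = k *s translate e P" using LP[OF \<open>P \<in> E\<close>] by blast
    then have "(L *v P) $ 1 * translate e P $ 3 - (L *v P) $ 3 * translate e P $ 1 = 0" by simp
    then show ?thesis unfolding Lv by (simp add: power2_eq_square algebra_simps)
  qed
  note m13 = quadratic_zero[OF this]
  have "L$1$2 = 0" "L$1$3 = 0" "L$2$1 = 0" "L$2$3 = 0" "L$3$1 = 0" "L$3$2 = 0"
    "L$2$2 = - e * L$1$1" "L$3$3 = e\<^sup>2 * L$1$1"
    using m12 m13 e0 by simp_all
  then have Leq: "L *v P = L$1$1 *s translate e P" for P
    unfolding vec3_eq_iff Lv by simp
  \<comment> \<open>A sum is a point of E, hence a nonzero vector; this excludes the scalar
    zero.\<close>
  moreover have "L *v R \<noteq> 0"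
    using L[OF R(1)] line_section_curve3 unfolding is_sum_iff by (fastforce simp: curve_def)
  then have "L$1$1 \<noteq> 0" using Leq[of R] by auto
  ultimately show thesis using that unfolding e_def by blast
qed

lemma is_sum_neg:
  assumes "R \<in> E" shows "is_sum a d R (neg R) origin"
proof -
  have "line_section a d R (neg R) origin"
    using line_section_origin[OF assms] line_section_swap12 line_section_swap23 by blast
  then have "line_section a d R (neg R) (- 1 *s origin)" by (rule line_section_scale3) simp
  moreover have "neg (origin :: 'a ^ 3) = - 1 *s origin" by (simp add: vec3_eq_iff)
  ultimately show ?thesis unfolding is_sum_iff by simp
qed

text \<open>The opposite point is the swap of Y and Z, so its slope is the inverse 1/e, which equals
  -e^2 because e^3 = -1.\<close>

lemma opposite_slope:
  assumes R: "R \<in> E" "R$1 = 0" and R': "is_sum a d R R' origin"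
  shows "R' \<in> E" "R' $ 1 = 0" "R'$3 / R'$2 = - (R$3 / R$2)\<^sup>2"
proof -
  show "R' \<in> E" using R' line_section_curve2 unfolding is_sum_iff by blast
  obtain k where k: "k \<noteq> 0" "R' = k *s neg R"
    using is_sum_unique_summand[OF is_sum_neg[OF R(1)] R'] .
  then show "R' $ 1 = 0" using R(2) by simp
  define e where "e = R$3 / R$2"
  have e: "e ^ 3 = - 1" "R$2 \<noteq> 0" using X0_slope[OF R] by (simp_all add: e_def)
  then have "e * (- e\<^sup>2) = 1" "e \<noteq> 0" by (auto simp: power2_eq_square power3_eq_cube mult.assoc)
  then have "- e\<^sup>2 = 1 / e" by (metis nonzero_eq_divide_eq mult.commute)
  then show "R'$3 / R'$2 = - (R$3 / R$2)\<^sup>2" using k e by (simp add: e_def)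
qed

text \<open>All monomials of one law acquire the same factor under the opposite translations.
  Besides the square scalars it is 1, e^2 or -e; these are the three characters of G, with cube
  roots of unity as values.\<close>

lemma laws_translate:
  fixes k m e :: 'a
  assumes "e ^ 3 = - 1"
  shows "law0_at (k *s translate e P) (m *s translate (- e\<^sup>2) Q) = (k\<^sup>2 * m\<^sup>2) *s law0_at P Q"
    "law1_at a (k *s translate e P) (m *s translate (- e\<^sup>2) Q) = (k\<^sup>2 * m\<^sup>2 * e\<^sup>2) *s law1_at a P Q"
    "law2_at a (k *s translate e P) (m *s translate (- e\<^sup>2) Q) = (k\<^sup>2 * m\<^sup>2 * (- e)) *s law2_at a P Q"
proof -
  have e: "e * (e * e) = - 1" "e * (e * (e * x)) = - x" for x
    using assms by (simp_all add: power3_eq_cube flip: mult.assoc)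
  show "law0_at (k *s translate e P) (m *s translate (- e\<^sup>2) Q) = (k\<^sup>2 * m\<^sup>2) *s law0_at P Q"
    "law1_at a (k *s translate e P) (m *s translate (- e\<^sup>2) Q) = (k\<^sup>2 * m\<^sup>2 * e\<^sup>2) *s law1_at a P Q"
    "law2_at a (k *s translate e P) (m *s translate (- e\<^sup>2) Q) = (k\<^sup>2 * m\<^sup>2 * (- e)) *s law2_at a P Q"
    by (simp_all add: vec3_eq_iff power2_eq_square algebra_simps e)
qed

end

section \<open>From the algebraic closure back to the field k\<close>

lemma addition_law_space_iff:
  "s \<in> addition_law_space a d \<longleftrightarrow> s \<in> bidegree22 \<and>
     (\<forall>P\<in>curve (to_ac a) (to_ac d). \<forall>Q\<in>curve (to_ac a) (to_ac d).
        value_at P Q s = 0 \<or> is_sum (to_ac a) (to_ac d) P Q (value_at P Q s))"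
  unfolding addition_law_space_def addition_law_def cong_EE_0_iff value_at_def[symmetric] by auto

lemma addition_law_iff:
  "addition_law a d s \<longleftrightarrow> s \<in> addition_law_space a d \<and>
     (\<exists>P\<in>curve (to_ac a) (to_ac d). \<exists>Q\<in>curve (to_ac a) (to_ac d). value_at P Q s \<noteq> 0)"
  unfolding addition_law_space_iff addition_law_def cong_EE_0_iff value_at_def[symmetric] by auto

text \<open>The excluded parameters have explicit singular points: (1 : 0 : 0) for a = 0, and (3 : d
  : d) for 27a = d^3, the latter a nonzero vector because 3 is invertible.\<close>

lemma smooth_hessian_to_ac:
  fixes a d :: "'a::field"
  assumes "CHAR('a) \<noteq> 3" "hessian_nonsingular a d"
  shows "smooth_hessian (to_ac a) (to_ac d)"
proof -
  have three: "(3 :: 'a) \<noteq> 0"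
  proof
    assume "(3 :: 'a) = 0"
    then have "of_nat 3 = (0 :: 'a)" by simp
    then have "CHAR('a) dvd 3" by (simp only: of_nat_eq_0_iff_char_dvd)
    moreover have "Factorial_Ring.prime (3 :: nat)" by simp
    ultimately have "CHAR('a) = 1 \<or> CHAR('a) = 3" unfolding prime_nat_iff by blast
    then show False using assms(1) CHAR_not_1'[where ?'a = 'a] by simp
  qed
  then have three': "(3 :: 'a alg_closure) \<noteq> 0" by (metis to_ac_eq_0_iff to_ac_numeral)
  have sing: False if "P \<noteq> 0" "hessian_form (to_ac a) (to_ac d) P = 0"
    "hessian_gradient (to_ac a) (to_ac d) P = 0" for P
    using assms(2) that unfolding hessian_nonsingular_def curve_def by blast
  have "a \<noteq> 0"
  proof
    assume "a = 0"
    then show False using sing[of "vector [1, 0, 0]"]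
      by (simp add: hessian_form_def hessian_gradient_def vec3_eq_iff)
  qed
  moreover have "27 * to_ac a \<noteq> to_ac d ^ 3"
  proof
    assume e: "27 * to_ac a = to_ac d ^ 3"
    then show False using sing[of "vector [3, to_ac d, to_ac d]"] three'
      by (simp add: hessian_form_def hessian_gradient_def vec3_eq_iff power2_eq_square power3_eq_cube algebra_simps)
  qed
  ultimately show ?thesis using three' by unfold_locales simp_all
qed

lemma value_at_form22:
  assumes "s \<in> bidegree22"
  shows "value_at P Q s $ i = form22 (\<lambda>r t. to_ac (Poly_Mapping.lookup (s $ i) (exponent r t))) P Q"
  using assms unfolding value_at_nth bidegree22_def
  by (intro coefficient_ac.subst_poly_bihomogeneous22) simp

lemma eval3_at_scale3:
  fixes c :: "'a::comm_ring_1"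
  shows "eval3_at P Q (scale3 c s) = c *s eval3_at P Q s"
  by (simp add: vec_eq_iff eval3_at_def scale3_def eval_at_def)

context
  fixes a d :: "'a::field"
  assumes smooth: "smooth_hessian (to_ac a) (to_ac d)"
begin

interpretation smooth_hessian "to_ac a" "to_ac d"
  by (rule smooth)

lemma subspace_addition_law_space: "triples.subspace (addition_law_space a d)"
proof (rule triples.subspaceI)
  show "0 \<in> addition_law_space a d"
    by (simp add: addition_law_space_iff bidegree22_0 value_at_0)
  show "s + t \<in> addition_law_space a d"
    if "s \<in> addition_law_space a d" "t \<in> addition_law_space a d" for s t
    using that unfolding addition_law_space_iff value_at_add
    by (intro conjI ballI bidegree22_add zero_or_sum_add) blast+
  show "scale3 c s \<in> addition_law_space a d" if "s \<in> addition_law_space a d" for c s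
    using that unfolding addition_law_space_iff value_at_scale3
    by (intro conjI ballI bidegree22_scale3 zero_or_sum_scale) blast+
qed

lemma laws_in_space: "{law0, law1 a, law2 a} \<subseteq> addition_law_space a d"
  using laws_zero_or_sum laws_bidegree22 unfolding addition_law_space_iff laws_at_def
  by (auto simp: value_at_laws addition_law_space_iff)

text \<open>\<open>form22_vanishing_determined\<close> is applied over the closure, but the
  coefficients that it supplies are images of coefficients of \<open>s\<close>; hence
  \<open>t\<close> can be written down over k.\<close>

lemma addition_law_space_determined:
  assumes s: "s \<in> addition_law_space a d"
  obtains t where "t \<in> triples.span {law0, law1 a, law2 a}" "cong_EE a d (base_change3 s) (base_change3 t)"
proof -
  let ?c = "\<lambda>r t. Poly_Mapping.lookup (s $ 1) (exponent r t)"
  define t where "t = scale3 (- ?c (2,3) (1,1)) law0 + scale3 (?c (1,2) (2,2)) (law1 a)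
    + scale3 (?c (1,3) (3,3)) (law2 a)"
  have t: "t \<in> triples.span {law0, law1 a, law2 a}"
    unfolding t_def by (intro triples.span_add triples.span_scale triples.span_base) simp_all
  then have "t \<in> addition_law_space a d"
    using triples.span_minimal[OF laws_in_space subspace_addition_law_space] by blast
  with s have st: "s - t \<in> addition_law_space a d"
    by (rule triples.subspace_diff[OF subspace_addition_law_space])
  have s22: "s \<in> bidegree22" using s unfolding addition_law_space_iff by blast
  have "value_at P Q (s - t) = 0" if "P \<in> E" "Q \<in> E" for P Q
  proof (rule bidegree22_vanishes_if_X0[OF _ _ _ that])
    show "value_at P Q (s - t) $ i
        = form22 ((\<lambda>i r u. to_ac (Poly_Mapping.lookup ((s - t) $ i) (exponent r u))) i) P Q" for P Q i
      using st unfolding addition_law_space_iff by (intro value_at_form22) blast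
    show "value_at P Q (s - t) = 0 \<or> is_sum (to_ac a) (to_ac d) P Q (value_at P Q (s - t))"
      if "P \<in> E" "Q \<in> E" for P Q
      using st that unfolding addition_law_space_iff by blast
    show "value_at P Q (s - t) $ 1 = 0" for P Q
    proof -
      have z: "form22 (\<lambda>r t. to_ac (?c r t)) P Q = 0"
        if PQ: "P \<in> E" "Q \<in> E" "\<forall>S\<in>laws_at (to_ac a) P Q. S $ 1 = 0" for P Q
        using s PQ is_sum_X0[OF PQ, of "value_at P Q s"]
        unfolding addition_law_space_iff value_at_form22[OF s22, symmetric] by force
      have "value_at P Q s $ 1 = form22 (\<lambda>r t. to_ac (?c r t)) P Q"
        by (rule value_at_form22[OF s22])
      also have "\<dots> = - to_ac (?c (2,3) (1,1)) * law0_at P Q $ 1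
          + to_ac (?c (1,2) (2,2)) * law1_at (to_ac a) P Q $ 1
          + to_ac (?c (1,3) (3,3)) * law2_at (to_ac a) P Q $ 1"
        by (rule form22_vanishing_determined[OF z])
      also have "\<dots> = value_at P Q t $ 1"
        unfolding t_def value_at_add value_at_scale3 value_at_laws by (simp del: law_at_nth)
      finally have "value_at P Q s $ 1 = value_at P Q t $ 1" .
      then show ?thesis by (simp add: value_at_diff)
    qed
  qed
  then have "cong_EE a d (base_change3 s) (base_change3 t)"
    by (simp add: cong_EE_base_change_iff value_at_diff)
  with t show thesis by (rule that)
qed

lemma addition_law_space_eq:
  "addition_law_space a d = {s \<in> bidegree22. \<exists>t \<in> triples.span {law0, law1 a, law2 a}.
     cong_EE a d (base_change3 s) (base_change3 t)}"
proof (intro equalityI subsetI)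
  fix s assume s: "s \<in> addition_law_space a d"
  then have "s \<in> bidegree22" unfolding addition_law_space_iff by blast
  moreover obtain t where "t \<in> triples.span {law0, law1 a, law2 a}"
    "cong_EE a d (base_change3 s) (base_change3 t)"
    using addition_law_space_determined[OF s] .
  ultimately show "s \<in> {s \<in> bidegree22. \<exists>t \<in> triples.span {law0, law1 a, law2 a}.
     cong_EE a d (base_change3 s) (base_change3 t)}" by blast
next
  fix s assume "s \<in> {s \<in> bidegree22. \<exists>t \<in> triples.span {law0, law1 a, law2 a}.
     cong_EE a d (base_change3 s) (base_change3 t)}"
  then obtain t where s: "s \<in> bidegree22" and t: "t \<in> triples.span {law0, law1 a, law2 a}"
    and st: "cong_EE a d (base_change3 s) (base_change3 t)" by blast
  have "t \<in> addition_law_space a d"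
    using t triples.span_minimal[OF laws_in_space subspace_addition_law_space] by blast
  then show "s \<in> addition_law_space a d"
    using s st unfolding addition_law_space_iff cong_EE_base_change_iff by simp
qed

lemma laws_addition_law: "addition_law a d law0" "addition_law a d (law1 a)" "addition_law a d (law2 a)"
proof -
  have O: "origin \<in> E" by (simp add: curve_def hessian_form_def vec3_eq_iff)
  \<comment> \<open>The first law vanishes on the diagonal, so its nonvanishing is checked at (1 : y
    : 0) and the identity; for the other two laws the identity paired with itself suffices.\<close>
  obtain y where y: "y ^ 3 = - to_ac a" using nth_root_exists[of 3 "- to_ac a"] by auto
  define P :: "'a alg_closure ^ 3" where "P = vector [1, y, 0]"
  have P: "P$1 = 1" "P$2 = y" "P$3 = 0" by (simp_all add: P_def)
  have "P \<in> E" using y by (simp add: curve_def hessian_form_def vec3_eq_iff P)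
  moreover have "value_at P origin law0 $ 1 \<noteq> 0"
    "value_at origin origin (law1 a) $ 2 \<noteq> 0" "value_at origin origin (law2 a) $ 3 \<noteq> 0"
    by (simp_all add: value_at_laws P)
  then have "value_at P origin law0 \<noteq> 0" "value_at origin origin (law1 a) \<noteq> 0"
    "value_at origin origin (law2 a) \<noteq> 0"
    by auto
  ultimately show "addition_law a d law0" "addition_law a d (law1 a)" "addition_law a d (law2 a)"
    using laws_in_space O unfolding addition_law_iff by blast+
qed

section \<open>The three laws as eigenvectors of the translation action\<close>

lemma represents_pair_exists:
  assumes "R \<in> subgroup_X0 a d"
  shows "\<exists>L M. represents_pair a d R L M"
proof -
  have R: "R \<in> E" "R$1 = 0" using assms by (simp_all add: subgroup_X0_def)
  define D :: "'a alg_closure \<Rightarrow> 'a alg_closure ^ 3 ^ 3" where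
    "D e = vector [vector [1, 0, 0], vector [0, - e, 0], vector [0, 0, e\<^sup>2]]" for e
  have D: "D e *v P = translate e P" for e P
    by (simp add: vec3_eq_iff D_def matrix_vector_mult_def sum_3)
  have "induces_translation a d S (D (S$3 / S$2))" if "S \<in> E" "S$1 = 0" for S
    unfolding induces_translation_def D using is_sum_translate that by blast
  then have "represents_pair a d R (D (R$3 / R$2)) (D (neg R $ 3 / neg R $ 2))"
    unfolding represents_pair_def using R is_sum_neg[OF R(1)] neg_curve neg_nth(1) by metis
  then show ?thesis by blast
qed

text \<open>The matrices are known only up to scalars \<open>k\<close> and \<open>m\<close>;
  bidegree (2,2) turns these into the factor k^2 m^2, so it suffices to find a nonzero
  \<open>c\<close> for the normalised translations.\<close>

lemma G1_eigenvectorI: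
  assumes "addition_law a d s"
    and eig: "\<And>e. e ^ 3 = - 1 \<Longrightarrow> \<exists>c. c \<noteq> 0 \<and> (\<forall>k m P Q.
      value_at (k *s translate e P) (m *s translate (- e\<^sup>2) Q) s = (k\<^sup>2 * m\<^sup>2 * c) *s value_at P Q s)"
  shows "G1_eigenvector a d s"
  unfolding G1_eigenvector_def
proof (intro conjI ballI allI impI)
  fix R assume R': "R \<in> subgroup_X0 a d"
  then show "\<exists>L M. represents_pair a d R L M" by (rule represents_pair_exists)
  fix L M assume "represents_pair a d R L M"
  then obtain R' where pair: "R' \<in> E" "is_sum (to_ac a) (to_ac d) R R' origin"
    "induces_translation a d R L" "induces_translation a d R' M"
    unfolding represents_pair_def by blast
  have R: "R \<in> E" "R$1 = 0" using R' by (simp_all add: subgroup_X0_def)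
  define e where "e = R$3 / R$2"
  have e: "e ^ 3 = - 1" using X0_slope[OF R] by (simp add: e_def)
  obtain k where k: "k \<noteq> 0" "\<And>P. L *v P = k *s translate e P"
    using translation_matrix_unique[OF R] pair(3) unfolding induces_translation_def e_def by metis
  note R' = opposite_slope[OF R pair(2)]
  obtain m where m: "m \<noteq> 0" "\<And>P. M *v P = m *s translate (- e\<^sup>2) P"
    using translation_matrix_unique[OF R'(1,2)] pair(4)
    unfolding induces_translation_def R'(3) e_def by metis
  obtain c where c: "c \<noteq> 0" "\<And>k m P Q.
      value_at (k *s translate e P) (m *s translate (- e\<^sup>2) Q) s = (k\<^sup>2 * m\<^sup>2 * c) *s value_at P Q s"
    using eig[OF e] by blast
  have "eval3_at P Q (compose_linear L M (base_change3 s))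
      = eval3_at P Q (scale3 (k\<^sup>2 * m\<^sup>2 * c) (base_change3 s))" for P Q
    unfolding eval3_at_compose_linear eval3_at_scale3 value_at_def[symmetric] k m c ..
  then show "\<exists>c. c \<noteq> 0 \<and> cong_EE a d (compose_linear L M (base_change3 s)) (scale3 c (base_change3 s))"
    using k m c by (intro exI[of _ "k\<^sup>2 * m\<^sup>2 * c"]) (simp add: cong_EE_iff_eval3_at)
qed (rule assms(1))

lemma laws_G1_eigenvector:
  assumes "s \<in> {law0, law1 a, law2 a}" shows "G1_eigenvector a d s"
proof (rule G1_eigenvectorI)
  show "addition_law a d s" using assms laws_addition_law by blast
  fix e :: "'a alg_closure" assume e: "e ^ 3 = - 1"
  then have e0: "e\<^sup>2 \<noteq> 0" "- e \<noteq> 0" by auto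
  consider "s = law0" | "s = law1 a" | "s = law2 a" using assms by blast
  then show "\<exists>c. c \<noteq> 0 \<and> (\<forall>k m P Q.
      value_at (k *s translate e P) (m *s translate (- e\<^sup>2) Q) s = (k\<^sup>2 * m\<^sup>2 * c) *s value_at P Q s)"
  proof cases
    case 1
    then show ?thesis by (intro exI[of _ 1]) (simp add: value_at_laws laws_translate(1)[OF e])
  next
    case 2
    then show ?thesis using e0(1)
      by (intro exI[of _ "e\<^sup>2"]) (simp only: value_at_laws laws_translate(2)[OF e], simp)
  next
    case 3
    then show ?thesis using e0(2)
      by (intro exI[of _ "- e"]) (simp only: value_at_laws laws_translate(3)[OF e], simp)
  qed
qed

end

theorem theorem9:
  fixes a d :: "'a::field"
  assumes "CHAR('a) \<noteq> 3"
    and "hessian_nonsingular a d"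
  shows "triples.subspace (addition_law_space a d) \<and>
         addition_law_space a d =
           {s \<in> bidegree22. \<exists>t \<in> triples.span {law0, law1 a, law2 a}.
              cong_EE a d (base_change3 s) (base_change3 t)} \<and>
         (\<forall>s \<in> {law0, law1 a, law2 a}. G1_eigenvector a d s)"
proof -
  have smooth: "smooth_hessian (to_ac a) (to_ac d)" using assms by (rule smooth_hessian_to_ac)
  show ?thesis
    using subspace_addition_law_space[OF smooth] addition_law_space_eq[OF smooth]
      laws_G1_eigenvector[OF smooth] by blast
qed

end
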